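(* Let $G$ be a finite group, and let $I \subset \mathbb{Z}$ be the set of integers that can occur as the coefficient $n_G$ (the coefficient of the subgroup $H = G$) in Brauer relations $\sum_{H} n_H H$ in $G$. Then \begin{itemize} \item $I = \{0\}$ if $G$ is cyclic; \item $I = p\mathbb{Z}$ if $p$ is a prime such that $G$ is $p$-quasi-elementary, and $G$ is not cyclic; \item $I = \mathbb{Z}$ if $G$ is not quasi-elementary. \end{itemize}
   Context: For a prime $p$, a finite group $G$ is called $p$-quasi-elementary if it has a cyclic normal subgroup whose index in $G$ is a power of $p$ (the index $1 = p^0$ is allowed). A finite group is called quasi-elementary if it is $p$-quasi-elementary for some prime $p$. For a subgroup $H \le G$, $\mathbf{1}_H$ denotes the trivial character of $H$ and $\mathrm{Ind}_H^G \mathbf{1}_H$ denotes the character of $G$ induced from it. A Brauer relation in $G$ is a formal $\mathbb{Z}$-linear combination $\sum_H n_H H$ (with $n_H \in \mathbb{Z}$) of subgroups $H$ of $G$, not necessarily proper (so $H = G$ is allowed), such that $\sum_H n_H \, \mathrm{Ind}_H^G \mathbf{1}_H = 0$ as a virtual character of $G$. *)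

theory Defs
  imports
    Complex_Main
    "HOL-Computational_Algebra.Primes"
    "HOL-Algebra.Elementary_Groups"
    "HOL-Algebra.Free_Abelian_Groups"
begin

definition p_quasi_elementary :: "nat \<Rightarrow> ('a, 'b) monoid_scheme \<Rightarrow> bool" where
  "p_quasi_elementary p G \<longleftrightarrow>
     prime p \<and> group G \<and> finite (carrier G) \<and>
     (\<exists>C. C \<lhd> G \<and> cyclic_group (G\<lparr>carrier := C\<rparr>) \<and>
          (\<exists>k::nat. card (rcosets\<^bsub>G\<^esub> C) = p ^ k))"

definition quasi_elementary :: "('a, 'b) monoid_scheme \<Rightarrow> bool" where
  "quasi_elementary G \<longleftrightarrow> (\<exists>p. p_quasi_elementary p G)"

definition trivial_character :: "'a \<Rightarrow> complex" where
  "trivial_character = (\<lambda>_. 1)"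

text \<open>
  The usual formula for induction of a class function \<open>\<chi>\<close> on a subgroup \<open>H\<close> of a finite group \<open>G\<close>.
  Only the values of \<open>\<chi>\<close> on \<open>H\<close> matter.
\<close>

definition induced_character ::
    "('a, 'b) monoid_scheme \<Rightarrow> 'a set \<Rightarrow> ('a \<Rightarrow> complex) \<Rightarrow> 'a \<Rightarrow> complex" where
  "induced_character G H \<chi> g =
     (\<Sum>x \<in> {x \<in> carrier G. inv\<^bsub>G\<^esub> x \<otimes>\<^bsub>G\<^esub> g \<otimes>\<^bsub>G\<^esub> x \<in> H}.
        \<chi> (inv\<^bsub>G\<^esub> x \<otimes>\<^bsub>G\<^esub> g \<otimes>\<^bsub>G\<^esub> x)) / of_nat (card H)"

text \<open>
  Subgroups are literal subsets of \<open>carrier G\<close>, not conjugacy classes of subgroups.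
  A virtual character is zero if it vanishes at every element of \<open>G\<close>.
\<close>

definition Brauer_relation :: "('a, 'b) monoid_scheme \<Rightarrow> ('a set \<Rightarrow>\<^sub>0 int) \<Rightarrow> bool" where
  "Brauer_relation G n \<longleftrightarrow>
     n \<in> carrier (free_Abelian_group {H. subgroup H G}) \<and>
     (\<forall>g \<in> carrier G.
        (\<Sum>H \<in> Poly_Mapping.keys n.
           of_int (Poly_Mapping.lookup n H) * induced_character G H trivial_character g) = 0)"

definition Brauer_coefficients :: "('a, 'b) monoid_scheme \<Rightarrow> int set" where
  "Brauer_coefficients G = {Poly_Mapping.lookup n (carrier G) | n. Brauer_relation G n}"

end

theory Submission
  imports Defs "HOL-Algebra.Sylow" "HOL-Algebra.Group_Action" "HOL-Algebra.Left_Coset"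
    "HOL-Algebra.Multiplicative_Group" "HOL-Algebra.SndIsomorphismGrp"
begin

text \<open>
  For a subgroup \<open>H\<close> of a finite group \<open>G\<close>, the character induced from the trivial character of \<open>H\<close>
  counts fixed points: its value \<open>mark H g\<close> is the number of cosets in \<open>G / H\<close> fixed by \<open>g\<close>. Let \<open>A\<close>
  (\<open>proper_span\<close>) be the set of integral combinations of these functions for proper \<open>H\<close>. It is closed
  under products, because \<open>G / H \<times> G / K\<close> is a disjoint union of coset spaces of proper subgroups.
  Since \<open>mark G\<close> is constantly 1, the integer \<open>n\<close> is the coefficient of \<open>G\<close> in some Brauer relation iff
  the constant function \<open>n\<close> lies in \<open>A\<close>. So the theorem is about the ideal \<open>J\<close>
  (\<open>proper_constants\<close>) of constants in \<open>A\<close>.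

  If \<open>G\<close> is cyclic with generator \<open>x\<close>, then \<open>x\<close> has no fixed point on \<open>G / H\<close> for proper \<open>H\<close>, so all of
  \<open>A\<close> vanishes at \<open>x\<close> and \<open>J = 0\<close>.

  The basic congruence (\<open>card_fixed_points_cong\<close>) is that a normal subgroup of \<open>p\<close>-power index has, modulo
  \<open>p\<close>, as many fixed points in a finite \<open>G\<close>-set as \<open>G\<close> itself. If \<open>G\<close> has a normal cyclic subgroup
  generated by \<open>c\<close> of \<open>p\<close>-power index, it follows that \<open>mark H c\<close> is divisible by \<open>p\<close> for every proper
  \<open>H\<close>, because \<open>G\<close> has no fixed point on \<open>G / H\<close>. Hence \<open>J \<subseteq> p\<int>\<close>.

  In the other direction, for every prime \<open>q\<close> and every \<open>g\<close> there is a \<open>q\<close>-quasi-elementary subgroup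
  \<open>Q\<close> such that \<open>q\<close> does not divide \<open>mark Q g\<close> (\<open>exists_mark_not_dvd\<close>). If \<open>G\<close> is not
  \<open>q\<close>-quasi-elementary, then \<open>Q\<close> is proper. The product of the functions \<open>mark Q g - mark Q\<close>, taken over
  all \<open>g\<close>, vanishes everywhere; expanding it shows that the product of the numbers \<open>mark Q g\<close>, which
  is prime to \<open>q\<close>, lies in \<open>J\<close>. If \<open>G\<close> is quasi-elementary for no prime, this gives \<open>J = \<int>\<close>.

  Finally let \<open>G\<close> be \<open>p\<close>-quasi-elementary and not cyclic. Then \<open>G\<close> is not \<open>q\<close>-quasi-elementary for any
  other prime \<open>q\<close> (\<open>cyclic_if_quasi_elementary_two_primes\<close>), so only \<open>p\<close> itself needs attention: it
  suffices to find an element \<open>p u\<close> of \<open>J\<close> with \<open>u\<close> prime to \<open>p\<close>. If \<open>G\<close> has two normal subgroups of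
  index \<open>p\<close>, it has a quotient of order \<open>p\<^sup>2\<close> which is not cyclic, and the well-known relation there gives
  \<open>p \<in> J\<close> (\<open>prime_mem_proper_constants_of_two_normal\<close>). Otherwise, consider an element \<open>g\<close> for which
  every proper \<open>H\<close> has \<open>mark H g\<close> divisible by \<open>p\<close>. For it the subgroup \<open>Q\<close> above is \<open>G\<close>, and then \<open>g\<close>
  generates a subgroup that contains a normal subgroup of \<open>G\<close> of \<open>p\<close>-power index and that is proper
  since \<open>G\<close> is not cyclic. So \<open>g\<close> lies in the unique normal subgroup \<open>M\<close> of index \<open>p\<close>, where \<open>mark M\<close>
  has the value \<open>p\<close>. Adding the single factor \<open>p - mark M\<close> to the product above takes care of all these
  elements.
\<close>

text \<open>The ASCII notation for strict inclusion of multisets clashes with left cosets.\<close>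

no_notation (ASCII) subset_mset (infix \<open><#\<close> 50)

section \<open>Subgroups and their orders\<close>

lemma (in group) card_subgroup_dvd:
  assumes "subgroup K G" "subgroup H G" "K \<subseteq> H"
  shows "card K dvd card H"
proof -
  have "subgroup K (G\<lparr>carrier := H\<rparr>)" by (rule subgroup_incl[OF assms])
  then have "card (rcosets\<^bsub>G\<lparr>carrier := H\<rparr>\<^esub> K) * card K = card H"
    using group.lagrange[OF subgroup_imp_group[OF assms(2)]] by (simp add: order_def)
  then show ?thesis by (metis dvd_triv_right)
qed

section \<open>Finite group actions\<close>

text \<open>In \<^locale>\<open>group_action\<close> the bijections are extensional, hence the restriction to \<open>E\<close>.\<close>

lemma (in group) group_actionI:
  assumes "\<And>g e. \<lbrakk>g \<in> carrier G; e \<in> E\<rbrakk> \<Longrightarrow> act g e \<in> E"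
    and "\<And>e. e \<in> E \<Longrightarrow> act \<one> e = e"
    and "\<And>g h e. \<lbrakk>g \<in> carrier G; h \<in> carrier G; e \<in> E\<rbrakk> \<Longrightarrow> act (g \<otimes> h) e = act g (act h e)"
  shows "group_action G E (\<lambda>g. \<lambda>e\<in>E. act g e)"
proof -
  have bij: "(\<lambda>e\<in>E. act g e) \<in> Bij E" if g: "g \<in> carrier G" for g
  proof -
    have "bij_betw (\<lambda>e\<in>E. act g e) E E"
    proof (rule bij_betw_byWitness[where f' = "act (inv g)"])
      show "\<forall>e\<in>E. act (inv g) ((\<lambda>e\<in>E. act g e) e) = e"
        using assms(2) assms(3)[of "inv g" g] g by auto
      show "\<forall>e\<in>E. (\<lambda>e\<in>E. act g e) (act (inv g) e) = e"
        using assms(1)[of "inv g"] assms(2) assms(3)[of g "inv g"] g by auto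
    qed (use assms(1) g in auto)
    then show ?thesis by (simp add: Bij_def)
  qed
  have "(\<lambda>g. \<lambda>e\<in>E. act g e) \<in> hom G (BijGroup E)"
  proof (rule homI)
    fix g assume "g \<in> carrier G"
    then show "(\<lambda>e\<in>E. act g e) \<in> carrier (BijGroup E)"
      using bij by (simp add: BijGroup_def)
  next
    fix g h assume gh: "g \<in> carrier G" "h \<in> carrier G"
    have "compose E (\<lambda>e\<in>E. act g e) (\<lambda>e\<in>E. act h e) = (\<lambda>e\<in>E. act (g \<otimes> h) e)"
      using assms(1,3) gh by (auto simp: compose_def restrict_def fun_eq_iff)
    then show "(\<lambda>e\<in>E. act (g \<otimes> h) e) = (\<lambda>e\<in>E. act g e) \<otimes>\<^bsub>BijGroup E\<^esub> (\<lambda>e\<in>E. act h e)"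
      using bij gh by (simp add: BijGroup_def)
  qed
  then show ?thesis
    by (simp add: group_action_def group_hom_def group_hom_axioms_def group_BijGroup is_group)
qed

text \<open>Fixed points of \<open>g\<close> in the orbit of \<open>e\<close>, counted through the map \<open>x \<mapsto> x e\<close>, whose
  fibres are cosets of the stabilizer.\<close>

lemma (in group_action) card_fixed_points_in_orbit:
  assumes fin: "finite (carrier G)" and e: "e \<in> E"
  shows "card {x \<in> carrier G. \<phi> g (\<phi> x e) = \<phi> x e}
       = card {y \<in> orbit G \<phi> e. \<phi> g y = y} * card (stabilizer G \<phi> e)"
proof -
  interpret G: group G using group_hom group_hom.axioms(1) by blast
  let ?Y = "{y \<in> orbit G \<phi> e. \<phi> g y = y}"
  let ?fib = "\<lambda>y. {x \<in> carrier G. \<phi> x e = y}"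
  have finY: "finite ?Y" using fin by (auto simp: orbit_def)
  \<comment> \<open>The fibre over \<open>\<phi> a e\<close> is the left coset of \<open>a\<close> modulo the stabilizer.\<close>
  have fib: "card (?fib y) = card (stabilizer G \<phi> e)" if "y \<in> ?Y" for y
  proof -
    obtain a where a: "a \<in> carrier G" "\<phi> a e = y" using \<open>y \<in> ?Y\<close> by (auto simp: orbit_def)
    have "bij_betw (\<lambda>s. a \<otimes> s) (stabilizer G \<phi> e) (?fib y)"
    proof (rule bij_betw_byWitness[where f' = "\<lambda>x. inv a \<otimes> x"])
      show "(\<lambda>s. a \<otimes> s) ` stabilizer G \<phi> e \<subseteq> ?fib y"
        using a e by (auto simp: stabilizer_def composition_rule)
      show "(\<lambda>x. inv a \<otimes> x) ` ?fib y \<subseteq> stabilizer G \<phi> e"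
        using a e orbit_sym_aux by (auto simp: stabilizer_def composition_rule)
    qed (use a in \<open>auto simp: stabilizer_def G.m_assoc[symmetric]\<close>)
    then show ?thesis by (simp add: bij_betw_same_card)
  qed
  have "{x \<in> carrier G. \<phi> g (\<phi> x e) = \<phi> x e} = (\<Union>y\<in>?Y. ?fib y)"
    by (auto simp: orbit_def)
  also have "card \<dots> = (\<Sum>y\<in>?Y. card (?fib y))"
    by (rule card_UN_disjoint) (use finY fin in auto)
  also have "\<dots> = card ?Y * card (stabilizer G \<phi> e)" using fib by simp
  finally show ?thesis .
qed

text \<open>If \<open>K\<close> is normal of \<open>p\<close>-power index, then \<open>G\<close> permutes the fixed points of \<open>K\<close> in orbits of
  \<open>p\<close>-power length, and the orbits of length 1 are the fixed points of \<open>G\<close>.\<close>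

lemma (in group_action) card_fixed_points_cong:
  assumes fin: "finite (carrier G)" "finite E" and p: "prime p"
    and K: "K \<lhd> G" "card (carrier G) = p ^ k * card K"
  shows "card {e \<in> E. \<forall>g\<in>carrier G. \<phi> g e = e} mod p = card {e \<in> E. \<forall>g\<in>K. \<phi> g e = e} mod p"
proof -
  interpret K: normal K G by (rule K)
  let ?F = "{e \<in> E. \<forall>g\<in>K. \<phi> g e = e}"
  let ?F1 = "{e \<in> E. \<forall>g\<in>carrier G. \<phi> g e = e}"
  let ?O = "orbit G \<phi> ` ?F"
  have K_sub: "K \<subseteq> carrier G" by (rule K.subset)
  have "K \<noteq> {}" using subgroup.one_closed[OF K.subgroup_axioms] by blast
  then have finK: "finite K" "card K > 0"
    using finite_subset[OF K_sub fin(1)] by (auto simp: card_gt_0_iff)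
  \<comment> \<open>As \<open>K\<close> is normal, \<open>G\<close> permutes the fixed points of \<open>K\<close>.\<close>
  have orb_F: "y \<in> ?F" if ey: "e \<in> ?F" "y \<in> orbit G \<phi> e" for e y
  proof -
    obtain a where a: "a \<in> carrier G" "\<phi> a e = y" using ey(2) by (auto simp: orbit_def)
    have yE: "y \<in> E" using element_image[of a e y] a ey(1) by blast
    have "\<phi> g y = y" if g: "g \<in> K" for g
    proof -
      have gG: "g \<in> carrier G" using g K_sub by blast
      have h: "inv a \<otimes> g \<otimes> a \<in> K" using K.inv_op_closed1 a(1) g by blast
      have "\<phi> g y = \<phi> (g \<otimes> a) e" using a gG \<open>e \<in> ?F\<close> by (auto simp: composition_rule)
      also have "g \<otimes> a = a \<otimes> (inv a \<otimes> g \<otimes> a)"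
        using a gG by (simp add: K.m_assoc[symmetric])
      also have "\<phi> \<dots> e = \<phi> a (\<phi> (inv a \<otimes> g \<otimes> a) e)"
        using a gG \<open>e \<in> ?F\<close> by (intro composition_rule) auto
      also have "\<dots> = y" using h \<open>e \<in> ?F\<close> a by auto
      finally show ?thesis .
    qed
    then show ?thesis using yE by auto
  qed
  have orb_sub: "?O \<subseteq> orbits G E \<phi>" by (auto simp: orbits_def)
  have union: "\<Union> ?O = ?F" using orb_F orbit_refl by fast
  have disj: "pairwise disjnt ?O" 
      proof (rule pairwiseI)
    fix A B assume "A \<in> ?O" "B \<in> ?O" "A \<noteq> B"
    then show "disjnt A B" using disjoint_union[of A B] orb_sub unfolding disjnt_def by blast
  qed
  have finF: "finite ?F" "finite ?O" using fin by auto
  have orb1: "orbit G \<phi> e = {e}" if e: "e \<in> ?F1" for e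
  proof -
    have "\<phi> g e = e" if "g \<in> carrier G" for g using e that by blast
    moreover have "e \<in> orbit G \<phi> e" using orbit_refl e by blast
    ultimately show ?thesis unfolding orbit_def by blast
  qed
  have one: "card (orbit G \<phi> e) = 1 \<longleftrightarrow> e \<in> ?F1" if e: "e \<in> ?F" for e
  proof
    assume "card (orbit G \<phi> e) = 1"
    then obtain y where "orbit G \<phi> e = {y}" by (auto simp: card_1_singleton_iff)
    then have orb: "orbit G \<phi> e = {e}" using orbit_refl[of e] e by auto
    have "\<phi> g e = e" if "g \<in> carrier G" for g
      using orb that unfolding orbit_def by blast
    then show "e \<in> ?F1" using e by blast
  next
    assume "e \<in> ?F1"
    then show "card (orbit G \<phi> e) = 1" using orb1 by simp
  qed
  have dvd: "p dvd card (orbit G \<phi> e)" if "e \<in> ?F" "e \<notin> ?F1" for e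
  proof -
    have eE: "e \<in> E" using that by blast
    have "K \<subseteq> stabilizer G \<phi> e" using K_sub that(1) unfolding stabilizer_def by blast
    moreover have st: "subgroup (stabilizer G \<phi> e) G" by (rule stabilizer_subgroup[OF eE])
    ultimately have "card K dvd card (stabilizer G \<phi> e)"
      using K.card_subgroup_dvd[OF K.subgroup_axioms st] by blast
    then obtain t where t: "card (stabilizer G \<phi> e) = card K * t" by (auto elim: dvdE)
    have "card (orbit G \<phi> e) * (card K * t) = p ^ k * card K"
      using orbit_stabilizer_theorem[OF eE] K(2) t by (simp add: order_def)
    then have "card (orbit G \<phi> e) * t = p ^ k" using finK by (auto simp: card_gt_0_iff)
    then have "card (orbit G \<phi> e) dvd p ^ k" by (metis dvd_triv_left)
    then obtain i where "card (orbit G \<phi> e) = p ^ i" using p divides_primepow_nat by blast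
    moreover have "i \<noteq> 0" using one[OF that(1)] that(2) calculation by (metis power_0)
    ultimately show ?thesis by simp
  qed
  have "card ?F = (\<Sum>A\<in>?O. card A)"
  proof -
    have "finite A" if "A \<in> ?O" for A
      using finite_subset[OF _ finF(1)] union that by blast
    then show ?thesis
      using card_Union_disjoint[of ?O] disj union by simp
  qed
  also have "\<dots> = (\<Sum>A\<in>{A\<in>?O. card A = 1}. card A) + (\<Sum>A\<in>{A\<in>?O. card A \<noteq> 1}. card A)"
    using finF by (subst sum.union_disjoint[symmetric]) (auto intro!: sum.cong)
  also have "(\<Sum>A\<in>{A\<in>?O. card A = 1}. card A) = card ?F1"
  proof -
    have F1F: "?F1 \<subseteq> ?F" using K_sub by blast
    have "{A\<in>?O. card A = 1} = (\<lambda>e. {e}) ` ?F1"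
    proof
      show "{A\<in>?O. card A = 1} \<subseteq> (\<lambda>e. {e}) ` ?F1" 
      proof
        fix A assume "A \<in> {A\<in>?O. card A = 1}"
        then obtain e where e: "e \<in> ?F" "A = orbit G \<phi> e" "card A = 1" by blast
        then have "e \<in> ?F1" using one[OF e(1)] by simp
        then show "A \<in> (\<lambda>e. {e}) ` ?F1" using orb1 e(2) by blast
      qed
      show "(\<lambda>e. {e}) ` ?F1 \<subseteq> {A\<in>?O. card A = 1}" 
      proof
        fix A assume "A \<in> (\<lambda>e. {e}) ` ?F1"
        then obtain e where e: "e \<in> ?F1" "A = {e}" by blast
        then have "A = orbit G \<phi> e" "e \<in> ?F" using orb1 F1F by auto
        moreover have "card A = 1" using e(2) by simp
        ultimately show "A \<in> {A\<in>?O. card A = 1}" by blast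
      qed
    qed
    then have "(\<Sum>A\<in>{A\<in>?O. card A = 1}. card A) = sum card ((\<lambda>e. {e}) ` ?F1)"
      by (rule arg_cong)
    also have "\<dots> = (\<Sum>e\<in>?F1. card {e})"
      by (rule sum.reindex_cong[where l = "\<lambda>e. {e}"]) auto
    finally show ?thesis by simp
  qed
  finally have eq: "card ?F = card ?F1 + (\<Sum>A\<in>{A\<in>?O. card A \<noteq> 1}. card A)" .
  have "p dvd (\<Sum>A\<in>{A\<in>?O. card A \<noteq> 1}. card A)"
  proof (rule dvd_sum)
    fix A assume "A \<in> {A\<in>?O. card A \<noteq> 1}"
    then obtain e where e: "e \<in> ?F" "A = orbit G \<phi> e" "card A \<noteq> 1" by blast
    then have "e \<notin> ?F1" using one[OF e(1)] by simp
    then show "p dvd card A" using dvd e by blast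
  qed
  then obtain t where "(\<Sum>A\<in>{A\<in>?O. card A \<noteq> 1}. card A) = p * t" by (rule dvdE)
  then show ?thesis unfolding eq by simp
qed

section \<open>Marks\<close>

lemma (in group_action) conj_mem_stabilizer_iff:
  assumes "g \<in> carrier G" "x \<in> carrier G" "e \<in> E"
  shows "inv x \<otimes> g \<otimes> x \<in> stabilizer G \<phi> e \<longleftrightarrow> \<phi> g (\<phi> x e) = \<phi> x e"
proof -
  interpret G: group G using group_hom group_hom.axioms(1) by blast
  have xe: "\<phi> x e \<in> E" using assms element_image by blast
  then have gxe: "\<phi> g (\<phi> x e) \<in> E" using assms element_image by blast
  have "inv x \<otimes> g \<otimes> x = inv x \<otimes> (g \<otimes> x)" using assms by (simp add: G.m_assoc)
  then have eq: "\<phi> (inv x \<otimes> g \<otimes> x) e = \<phi> (inv x) (\<phi> g (\<phi> x e))"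
    using assms by (simp add: composition_rule)
  have "\<phi> (inv x) (\<phi> g (\<phi> x e)) = e \<longleftrightarrow> \<phi> g (\<phi> x e) = \<phi> x e"
  proof
    assume "\<phi> (inv x) (\<phi> g (\<phi> x e)) = e"
    then have "\<phi> (inv (inv x)) e = \<phi> g (\<phi> x e)"
      using orbit_sym_aux[of "inv x" "\<phi> g (\<phi> x e)" e] assms gxe by simp
    then show "\<phi> g (\<phi> x e) = \<phi> x e" using assms by simp
  next
    assume "\<phi> g (\<phi> x e) = \<phi> x e"
    then show "\<phi> (inv x) (\<phi> g (\<phi> x e)) = e" using orbit_sym_aux[of x e] assms by simp
  qed
  then show ?thesis using assms eq by (simp add: stabilizer_def)
qed

text \<open>The ambient finite group.\<close>

locale finite_group = group +
  assumes finite_carrier [simp, intro]: "finite (carrier G)"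
begin

text \<open>The mark of \<open>g\<close> on \<open>G / H\<close>: the number of left cosets \<open>x H\<close> fixed by \<open>g\<close>, that is, with
  \<open>inv x \<otimes> g \<otimes> x \<in> H\<close>. The defining formula mirrors that of the induced character; the division is exact
  for every subgroup \<open>H\<close> by \<open>mark_mult_card\<close> below.\<close>

definition mark :: "'a set \<Rightarrow> 'a \<Rightarrow> nat" where
  "mark H g = card {x \<in> carrier G. inv x \<otimes> g \<otimes> x \<in> H} div card H"

lemma finite_subgroup: "subgroup H G \<Longrightarrow> finite H"
  using finite_subset[OF subgroup.subset finite_carrier] by blast

lemma card_subgroup_pos: "subgroup H G \<Longrightarrow> 0 < card H"
  using finite_subgroup subgroup.one_closed by (fastforce simp: card_gt_0_iff)

lemma group_action_lcosets:
  assumes "subgroup H G"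
  shows "group_action G (lcosets H) (\<lambda>g. \<lambda>A\<in>lcosets H. g <# A)"
proof (rule group_actionI)
  have sub: "H \<subseteq> carrier G" using subgroup.subset[OF assms] .
  show "g <# A \<in> lcosets H" if "g \<in> carrier G" "A \<in> lcosets H" for g A
    using that sub by (auto simp: LCOSETS_def lcos_m_assoc)
  show "\<one> <# A = A" if "A \<in> lcosets H" for A
    using that sub by (auto simp: LCOSETS_def lcos_m_assoc)
  show "g \<otimes> h <# A = g <# (h <# A)" if "g \<in> carrier G" "h \<in> carrier G" "A \<in> lcosets H" for g h A
    using that sub by (auto simp: LCOSETS_def lcos_m_assoc m_assoc)
qed

lemma finite_lcosets [simp]: "finite (lcosets H)"
  by (simp add: LCOSETS_def)

lemma subgroup_mem_lcosets: "subgroup H G \<Longrightarrow> H \<in> lcosets H"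
  using lcos_mult_one[OF subgroup.subset] one_closed by (force simp: LCOSETS_def)

lemma l_coset_eq_self_iff:
  assumes "subgroup H G" "x \<in> carrier G"
  shows "x <# H = H \<longleftrightarrow> x \<in> H"
  using coset_join3[OF assms(2,1)] lcos_self[OF assms(2,1)] by blast

lemma l_coset_fixed_iff:
  assumes "subgroup H G" "x \<in> carrier G" "g \<in> carrier G"
  shows "g <# (x <# H) = x <# H \<longleftrightarrow> inv x \<otimes> g \<otimes> x \<in> H"
proof -
  have sub: "H \<subseteq> carrier G" using subgroup.subset[OF assms(1)] .
  have "(g <# (x <# H) = x <# H) = (inv x <# (g <# (x <# H)) = inv x <# (x <# H))"
  proof
    assume "inv x <# (g <# (x <# H)) = inv x <# (x <# H)"
    then have "x <# (inv x <# (g <# (x <# H))) = x <# (inv x <# (x <# H))" by simp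
    then show "g <# (x <# H) = x <# H"
      using assms sub by (simp add: lcos_m_assoc m_assoc[symmetric])
  qed simp
  also have "\<dots> = ((inv x \<otimes> g \<otimes> x) <# H = H)"
    using assms sub by (simp add: lcos_m_assoc lcos_mult_one m_assoc)
  also have "\<dots> = (inv x \<otimes> g \<otimes> x \<in> H)" using l_coset_eq_self_iff assms by simp
  finally show ?thesis .
qed

lemma eq_carrier_if_l_coset_fixed:
  assumes "subgroup H G" "x \<in> carrier G" "\<And>g. g \<in> carrier G \<Longrightarrow> g <# (x <# H) = x <# H"
  shows "H = carrier G"
proof -
  have "h \<in> H" if h: "h \<in> carrier G" for h
  proof -
    have "inv x \<otimes> (x \<otimes> h \<otimes> inv x) \<otimes> x \<in> H"
      using l_coset_fixed_iff[OF assms(1,2), of "x \<otimes> h \<otimes> inv x"] assms(2,3) h by simp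
    moreover have "inv x \<otimes> (x \<otimes> h \<otimes> inv x) \<otimes> x = h"
      using h assms(2) by (simp add: m_assoc) (simp add: m_assoc[symmetric])
    ultimately show ?thesis by simp
  qed
  then show ?thesis using subgroup.subset[OF assms(1)] by blast
qed

lemma lcosets_stabilizer_orbit:
  assumes "subgroup H G"
  shows "stabilizer G (\<lambda>g. \<lambda>A\<in>lcosets H. g <# A) H = H"
    and "orbit G (\<lambda>g. \<lambda>A\<in>lcosets H. g <# A) H = lcosets H"
  using subgroup_mem_lcosets[OF assms] l_coset_eq_self_iff[OF assms] subgroup.subset[OF assms]
  by (auto simp: stabilizer_def orbit_def LCOSETS_def)

text \<open>The orbit of \<open>e\<close> is isomorphic to \<open>G / H\<close> for the stabilizer \<open>H\<close> of \<open>e\<close>, so marks count the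
  fixed points in it.\<close>

lemma mark_stabilizer:
  assumes act: "group_action G E \<phi>" and "e \<in> E" "g \<in> carrier G"
  shows "mark (stabilizer G \<phi> e) g = card {y \<in> orbit G \<phi> e. \<phi> g y = y}"
    and "card {x \<in> carrier G. inv x \<otimes> g \<otimes> x \<in> stabilizer G \<phi> e}
      = mark (stabilizer G \<phi> e) g * card (stabilizer G \<phi> e)"
proof -
  interpret group_action G E \<phi> by (rule act)
  have "{x \<in> carrier G. inv x \<otimes> g \<otimes> x \<in> stabilizer G \<phi> e}
      = {x \<in> carrier G. \<phi> g (\<phi> x e) = \<phi> x e}"
    using conj_mem_stabilizer_iff assms by blast
  then have eq: "card {x \<in> carrier G. inv x \<otimes> g \<otimes> x \<in> stabilizer G \<phi> e}
      = card {y \<in> orbit G \<phi> e. \<phi> g y = y} * card (stabilizer G \<phi> e)"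
    using card_fixed_points_in_orbit[OF finite_carrier assms(2)] by simp
  then show m: "mark (stabilizer G \<phi> e) g = card {y \<in> orbit G \<phi> e. \<phi> g y = y}"
    using card_subgroup_pos[OF stabilizer_subgroup[OF assms(2)]] by (simp add: mark_def)
  show "card {x \<in> carrier G. inv x \<otimes> g \<otimes> x \<in> stabilizer G \<phi> e}
      = mark (stabilizer G \<phi> e) g * card (stabilizer G \<phi> e)"
    using eq m by simp
qed

lemma
  assumes "subgroup H G" "g \<in> carrier G"
  shows mark_eq_card_fixed: "mark H g = card {A \<in> lcosets H. g <# A = A}"
    and mark_mult_card: "mark H g * card H = card {x \<in> carrier G. inv x \<otimes> g \<otimes> x \<in> H}"
proof -
  note act = group_action_lcosets[OF assms(1)]
  have H: "H \<in> lcosets H" by (rule subgroup_mem_lcosets[OF assms(1)])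
  have "{A \<in> lcosets H. g <# A = A} = {A \<in> lcosets H. (\<lambda>A\<in>lcosets H. g <# A) A = A}" by auto
  then show "mark H g = card {A \<in> lcosets H. g <# A = A}"
    using mark_stabilizer(1)[OF act H assms(2)] lcosets_stabilizer_orbit[OF assms(1)] by simp
  show "mark H g * card H = card {x \<in> carrier G. inv x \<otimes> g \<otimes> x \<in> H}"
    using mark_stabilizer(2)[OF act H assms(2)] lcosets_stabilizer_orbit[OF assms(1)] by simp
qed

lemma card_lcosets:
  assumes H: "subgroup H G"
  shows "card (lcosets H) * card H = card (carrier G)"
proof -
  have "{A \<in> lcosets H. \<one> <# A = A} = lcosets H"
    using subgroup.subset[OF H] by (auto simp: LCOSETS_def lcos_m_assoc)
  moreover have "{x \<in> carrier G. inv x \<otimes> \<one> \<otimes> x \<in> H} = carrier G"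
    using subgroup.one_closed[OF H] by auto
  ultimately show ?thesis
    using mark_eq_card_fixed[OF H one_closed] mark_mult_card[OF H one_closed] by simp
qed

text \<open>Decomposition of a permutation character into those of the orbits.\<close>

lemma card_fixed_points_eq_sum_marks:
  assumes act: "group_action G E \<phi>" and "finite E" "g \<in> carrier G"
  shows "card {e \<in> E. \<phi> g e = e} = (\<Sum>A\<in>orbits G E \<phi>. mark (stabilizer G \<phi> (SOME e. e \<in> A)) g)"
proof -
  interpret group_action G E \<phi> by (rule act)
  have fin: "finite (orbits G E \<phi>)" using assms(2) by (auto simp: orbits_def)
  have "{e \<in> E. \<phi> g e = e} = (\<Union>A\<in>orbits G E \<phi>. {e \<in> A. \<phi> g e = e})"
    using orbits_coverture by blast
  also have "card \<dots> = (\<Sum>A\<in>orbits G E \<phi>. card {e \<in> A. \<phi> g e = e})"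
  proof (rule card_UN_disjoint[OF fin])
    show "\<forall>A\<in>orbits G E \<phi>. finite {e \<in> A. \<phi> g e = e}"
    proof
      fix A assume "A \<in> orbits G E \<phi>"
      then have "A \<subseteq> E" using orbits_coverture by blast
      then show "finite {e \<in> A. \<phi> g e = e}" using assms(2) by (simp add: finite_subset)
    qed
    show "\<forall>A\<in>orbits G E \<phi>. \<forall>B\<in>orbits G E \<phi>. A \<noteq> B \<longrightarrow> {e \<in> A. \<phi> g e = e} \<inter> {e \<in> B. \<phi> g e = e} = {}"
    proof (intro ballI impI)
      fix A B assume "A \<in> orbits G E \<phi>" "B \<in> orbits G E \<phi>" "A \<noteq> B"
      then have "A \<inter> B = {}" using disjoint_union by metis
      then show "{e \<in> A. \<phi> g e = e} \<inter> {e \<in> B. \<phi> g e = e} = {}" by blast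
    qed
  qed
  also have "\<dots> = (\<Sum>A\<in>orbits G E \<phi>. mark (stabilizer G \<phi> (SOME e. e \<in> A)) g)"
  proof (rule sum.cong[OF refl])
    fix A assume "A \<in> orbits G E \<phi>"
    then obtain a where a: "a \<in> E" "A = orbit G \<phi> a" by (auto simp: orbits_def)
    define e where "e = (SOME e. e \<in> A)"
    have "a \<in> A" using a orbit_refl by simp
    then have "e \<in> A" unfolding e_def by (rule someI)
    then have e: "e \<in> E" "e \<in> orbit G \<phi> a" using a element_image by (auto simp: orbit_def)
    have "orbit G \<phi> e \<in> orbits G E \<phi>" using e(1) by (auto simp: orbits_def)
    moreover have "e \<in> orbit G \<phi> e \<inter> A" using orbit_refl e a by simp
    ultimately have "orbit G \<phi> e = A"
      using disjoint_union[of "orbit G \<phi> e" A] \<open>A \<in> orbits G E \<phi>\<close> by blast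
    then show "card {e \<in> A. \<phi> g e = e} = mark (stabilizer G \<phi> (SOME e. e \<in> A)) g"
      using mark_stabilizer(1)[OF act e(1) assms(3)] by (simp add: e_def)
  qed
  finally show ?thesis .
qed

end

section \<open>The ideal of permutation characters spanned by proper subgroups\<close>

context finite_group
begin

definition proper_subgroups :: "'a set set" where
  "proper_subgroups = {H. subgroup H G \<and> H \<noteq> carrier G}"

text \<open>The integral combinations of the permutation characters on \<open>G / H\<close> for proper subgroups \<open>H\<close>.
  The values of these functions outside \<open>G\<close> are arbitrary.\<close>

definition proper_span :: "('a \<Rightarrow> int) set" where
  "proper_span = {f. \<exists>n :: 'a set \<Rightarrow> int. \<forall>g\<in>carrier G.
     f g = (\<Sum>H\<in>proper_subgroups. n H * int (mark H g))}"

lemma finite_proper_subgroups [simp]: "finite proper_subgroups"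
  by (rule finite_subset[of _ "Pow (carrier G)"]) (auto simp: proper_subgroups_def dest: subgroup.subset)

lemma proper_span_cong:
  "f \<in> proper_span \<Longrightarrow> (\<And>g. g \<in> carrier G \<Longrightarrow> f g = f' g) \<Longrightarrow> f' \<in> proper_span"
  by (auto simp: proper_span_def)

lemma proper_span_mark:
  assumes "H \<in> proper_subgroups"
  shows "(\<lambda>g. int (mark H g)) \<in> proper_span"
proof -
  have "int (mark H g) = (\<Sum>K\<in>proper_subgroups. (if K = H then 1 else 0) * int (mark K g))" for g
    using assms by (subst sum.remove[of _ H]) auto
  then show ?thesis
    unfolding proper_span_def by (auto intro!: exI[of _ "\<lambda>K. if K = H then 1 else 0"])
qed

lemma proper_span_add:
  assumes "f \<in> proper_span" "f' \<in> proper_span"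
  shows "(\<lambda>g. f g + f' g) \<in> proper_span"
proof -
  obtain n m where "\<forall>g\<in>carrier G. f g = (\<Sum>H\<in>proper_subgroups. n H * int (mark H g))"
    "\<forall>g\<in>carrier G. f' g = (\<Sum>H\<in>proper_subgroups. m H * int (mark H g))"
    using assms by (auto simp: proper_span_def)
  then have "\<forall>g\<in>carrier G. f g + f' g = (\<Sum>H\<in>proper_subgroups. (n H + m H) * int (mark H g))"
    by (simp add: sum.distrib distrib_right)
  then show ?thesis unfolding proper_span_def by (auto intro!: exI[of _ "\<lambda>H. n H + m H"])
qed

lemma proper_span_scale:
  assumes "f \<in> proper_span"
  shows "(\<lambda>g. c * f g) \<in> proper_span"
proof -
  obtain n where "\<forall>g\<in>carrier G. f g = (\<Sum>H\<in>proper_subgroups. n H * int (mark H g))"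
    using assms by (auto simp: proper_span_def)
  then have "\<forall>g\<in>carrier G. c * f g = (\<Sum>H\<in>proper_subgroups. (c * n H) * int (mark H g))"
    by (simp add: sum_distrib_left mult.assoc)
  then show ?thesis unfolding proper_span_def by (auto intro!: exI[of _ "\<lambda>H. c * n H"])
qed

lemma proper_span_zero: "(\<lambda>g. 0) \<in> proper_span"
  unfolding proper_span_def by (auto intro!: exI[of _ "\<lambda>H. 0"])

lemma proper_span_diff:
  assumes "f \<in> proper_span" "f' \<in> proper_span"
  shows "(\<lambda>g. f g - f' g) \<in> proper_span"
  using proper_span_add[OF assms(1) proper_span_scale[OF assms(2), of "-1"]] by simp

lemma proper_span_sum:
  assumes "\<And>i. i \<in> I \<Longrightarrow> f i \<in> proper_span"
  shows "(\<lambda>g. \<Sum>i\<in>I. f i g) \<in> proper_span"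
  using assms
proof (induction I rule: infinite_finite_induct)
  case (insert i I)
  then show ?case using proper_span_add[of "f i" "\<lambda>g. \<Sum>i\<in>I. f i g"] by simp
qed (simp_all add: proper_span_zero)

text \<open>The product of the permutation characters of \<open>G / H\<close> and \<open>G / K\<close> is that of
  \<open>G / H \<times> G / K\<close>, in which every stabilizer is contained in a conjugate of \<open>H\<close>.\<close>

lemma proper_span_mark_mult:
  assumes H: "H \<in> proper_subgroups" and K: "subgroup K G"
  shows "(\<lambda>g. int (mark H g) * int (mark K g)) \<in> proper_span"
proof -
  have HG: "subgroup H G" "H \<noteq> carrier G" using H by (auto simp: proper_subgroups_def)
  let ?E = "(lcosets H) \<times> (lcosets K)"
  let ?\<phi> = "\<lambda>g. \<lambda>e\<in>?E. (g <# fst e, g <# snd e)"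
  have sub: "H \<subseteq> carrier G" "K \<subseteq> carrier G" using HG(1) K subgroup.subset by auto
  have act: "group_action G ?E ?\<phi>"
  proof (rule group_actionI)
    show "(g <# fst e, g <# snd e) \<in> ?E" if "g \<in> carrier G" "e \<in> ?E" for g e
      using that sub by (auto simp: LCOSETS_def lcos_m_assoc)
    show "(\<one> <# fst e, \<one> <# snd e) = e" if "e \<in> ?E" for e
      using that sub by (auto simp: LCOSETS_def lcos_m_assoc)
    show "(g \<otimes> h <# fst e, g \<otimes> h <# snd e)
        = (g <# fst (h <# fst e, h <# snd e), g <# snd (h <# fst e, h <# snd e))"
      if "g \<in> carrier G" "h \<in> carrier G" "e \<in> ?E" for g h e
      using that sub by (auto simp: LCOSETS_def lcos_m_assoc m_assoc)
  qed
  interpret act: group_action G ?E ?\<phi> by (rule act)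
  let ?S = "\<lambda>A. stabilizer G ?\<phi> (SOME e. e \<in> A)"
  have prod: "int (mark H g) * int (mark K g) = (\<Sum>A\<in>orbits G ?E ?\<phi>. int (mark (?S A) g))"
    if g: "g \<in> carrier G" for g
  proof -
    have "{e \<in> ?E. ?\<phi> g e = e} = {A \<in> lcosets H. g <# A = A} \<times> {A \<in> lcosets K. g <# A = A}"
      by auto
    then have "card {e \<in> ?E. ?\<phi> g e = e} = mark H g * mark K g"
      using mark_eq_card_fixed[OF HG(1) g] mark_eq_card_fixed[OF K g]
      by (simp add: card_cartesian_product)
    then have "mark H g * mark K g = (\<Sum>A\<in>orbits G ?E ?\<phi>. mark (?S A) g)"
      using card_fixed_points_eq_sum_marks[OF act _ g] by simp
    then show ?thesis by (simp only: of_nat_mult[symmetric] of_nat_sum[symmetric])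
  qed
  have "(\<lambda>g. int (mark (?S A) g)) \<in> proper_span" if A: "A \<in> orbits G ?E ?\<phi>" for A
  proof (rule proper_span_mark)
    define e where "e = (SOME e. e \<in> A)"
    obtain a where a: "a \<in> ?E" "A = orbit G ?\<phi> a" using A by (auto simp: orbits_def)
    then have "a \<in> A" using act.orbit_refl by simp
    then have "e \<in> A" unfolding e_def by (rule someI)
    then have e: "e \<in> ?E" using A act.orbits_coverture by blast
    then obtain x B where x: "x \<in> carrier G" "e = (x <# H, B)" by (auto simp: LCOSETS_def)
    have "stabilizer G ?\<phi> e \<noteq> carrier G"
    proof
      assume st: "stabilizer G ?\<phi> e = carrier G"
      have "g <# (x <# H) = x <# H" if "g \<in> carrier G" for g
      proof -
        have "g \<in> stabilizer G ?\<phi> e" using st that by simp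
        then show ?thesis using e x by (simp add: stabilizer_def)
      qed
      then have "H = carrier G" by (rule eq_carrier_if_l_coset_fixed[OF HG(1) x(1)])
      then show False using HG(2) by simp
    qed
    then show "?S A \<in> proper_subgroups"
      using act.stabilizer_subgroup[OF e] by (simp add: e_def proper_subgroups_def)
  qed
  then have "(\<lambda>g. \<Sum>A\<in>orbits G ?E ?\<phi>. int (mark (?S A) g)) \<in> proper_span"
    by (rule proper_span_sum)
  then show ?thesis by (rule proper_span_cong) (simp add: prod)
qed

lemma proper_span_mult:
  assumes "f \<in> proper_span" "f' \<in> proper_span"
  shows "(\<lambda>g. f g * f' g) \<in> proper_span"
proof -
  obtain n m where nm: "\<forall>g\<in>carrier G. f g = (\<Sum>H\<in>proper_subgroups. n H * int (mark H g))"
    "\<forall>g\<in>carrier G. f' g = (\<Sum>H\<in>proper_subgroups. m H * int (mark H g))"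
    using assms by (auto simp: proper_span_def)
  have "(\<lambda>g. \<Sum>H\<in>proper_subgroups. \<Sum>K\<in>proper_subgroups.
      (n H * m K) * (int (mark H g) * int (mark K g))) \<in> proper_span"
    by (intro proper_span_sum proper_span_scale proper_span_mark_mult)
      (auto simp: proper_subgroups_def)
  then show ?thesis
    by (rule proper_span_cong) (subst sum.swap, simp add: nm sum_product mult_ac)
qed

text \<open>If every \<open>f i\<close> lies in the ideal, then so does \<open>\<Prod>v i - \<Prod>(v i - f i)\<close>.\<close>

lemma proper_span_prod:
  fixes f :: "'i \<Rightarrow> 'a \<Rightarrow> int" and v :: "'i \<Rightarrow> int"
  assumes "finite I" "\<And>i. i \<in> I \<Longrightarrow> f i \<in> proper_span"
  shows "(\<lambda>g. (\<Prod>i\<in>I. v i) - (\<Prod>i\<in>I. v i - f i g)) \<in> proper_span"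
  using assms
proof (induction I rule: finite_induct)
  case empty
  then show ?case by (simp add: proper_span_zero)
next
  case (insert i I)
  let ?a = "\<lambda>g. (\<Prod>i\<in>I. v i) - (\<Prod>i\<in>I. v i - f i g)"
  have a: "?a \<in> proper_span" and f: "f i \<in> proper_span" using insert by auto
  have "(\<lambda>g. (v i * ?a g + (\<Prod>i\<in>I. v i) * f i g) - f i g * ?a g) \<in> proper_span"
    by (intro proper_span_diff proper_span_add proper_span_scale proper_span_mult a f)
  then show ?case
    by (rule proper_span_cong) (simp add: insert algebra_simps)
qed

text \<open>The integers whose constant function lies in \<open>proper_span\<close>; they form an ideal of the integers.\<close>

definition proper_constants :: "int set" where
  "proper_constants = {c. (\<lambda>g. c) \<in> proper_span}"

lemma proper_constants_add: "a \<in> proper_constants \<Longrightarrow> b \<in> proper_constants \<Longrightarrow> a + b \<in> proper_constants"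
  unfolding proper_constants_def using proper_span_add[of "\<lambda>g. a" "\<lambda>g. b"] by simp

lemma proper_constants_mult: "a \<in> proper_constants \<Longrightarrow> c * a \<in> proper_constants"
  unfolding proper_constants_def using proper_span_scale[of "\<lambda>g. a" c] by simp

text \<open>If at every element of \<open>G\<close> some \<open>f i\<close> takes the value \<open>v i\<close>, then \<open>\<Prod>(v i - f i)\<close> vanishes on
  \<open>G\<close>.\<close>

lemma proper_constants_prod:
  fixes f :: "'i \<Rightarrow> 'a \<Rightarrow> int" and v :: "'i \<Rightarrow> int"
  assumes "finite I" "\<And>i. i \<in> I \<Longrightarrow> f i \<in> proper_span"
    and "\<And>g. g \<in> carrier G \<Longrightarrow> \<exists>i\<in>I. f i g = v i"
  shows "(\<Prod>i\<in>I. v i) \<in> proper_constants"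
proof -
  have "(\<Prod>i\<in>I. v i - f i g) = 0" if "g \<in> carrier G" for g
    using assms(1) assms(3)[OF that] by (intro prod_zero) (auto, metis)
  then show ?thesis
    using proper_span_cong[OF proper_span_prod[of I f v, OF assms(1,2)], of "\<lambda>g. \<Prod>i\<in>I. v i"]
    by (simp add: proper_constants_def)
qed

section \<open>Brauer relations\<close>

lemma induced_trivial_character:
  assumes "subgroup H G" "g \<in> carrier G"
  shows "induced_character G H trivial_character g = of_nat (mark H g)"
proof -
  have "of_nat (mark H g) * of_nat (card H)
      = (of_nat (card {x \<in> carrier G. inv x \<otimes> g \<otimes> x \<in> H}) :: complex)"
    using mark_mult_card[OF assms] by (metis of_nat_mult)
  then show ?thesis
    using card_subgroup_pos[OF assms(1)]
    by (simp add: induced_character_def trivial_character_def field_simps)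
qed

lemma mark_carrier:
  assumes "g \<in> carrier G"
  shows "mark (carrier G) g = 1"
proof -
  have "{x \<in> carrier G. inv x \<otimes> g \<otimes> x \<in> carrier G} = carrier G" using assms by auto
  then show ?thesis
    using card_subgroup_pos[OF subgroup_self] unfolding mark_def by (metis div_self less_not_refl)
qed

lemma finite_subgroups: "finite {H. subgroup H G}"
  by (rule finite_subset[of _ "Pow (carrier G)"]) (auto dest: subgroup.subset)

lemma subgroups_eq_insert: "{H. subgroup H G} = insert (carrier G) proper_subgroups"
  using subgroup_self by (auto simp: proper_subgroups_def)

lemma Brauer_relation_iff:
  "Brauer_relation G n \<longleftrightarrow> Poly_Mapping.keys n \<subseteq> {H. subgroup H G} \<and>
     (\<forall>g\<in>carrier G. Poly_Mapping.lookup n (carrier G)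
        + (\<Sum>H\<in>proper_subgroups. Poly_Mapping.lookup n H * int (mark H g)) = 0)"
proof -
  have "(\<Sum>H\<in>Poly_Mapping.keys n. of_int (Poly_Mapping.lookup n H)
        * induced_character G H trivial_character g)
      = of_int (Poly_Mapping.lookup n (carrier G)
        + (\<Sum>H\<in>proper_subgroups. Poly_Mapping.lookup n H * int (mark H g)))"
    if keys: "Poly_Mapping.keys n \<subseteq> {H. subgroup H G}" and g: "g \<in> carrier G" for g
  proof -
    have "(\<Sum>H\<in>Poly_Mapping.keys n. of_int (Poly_Mapping.lookup n H)
        * induced_character G H trivial_character g)
      = (\<Sum>H\<in>{H. subgroup H G}. of_int (Poly_Mapping.lookup n H)
        * induced_character G H trivial_character g)"
      by (rule sum.mono_neutral_left) (use keys finite_subgroups in \<open>auto simp: in_keys_iff\<close>)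
    also have "\<dots> = (\<Sum>H\<in>{H. subgroup H G}.
        of_int (Poly_Mapping.lookup n H * int (mark H g)))"
      using induced_trivial_character[OF _ g] by (intro sum.cong) auto
    also have "\<dots> = of_int (Poly_Mapping.lookup n (carrier G)
        + (\<Sum>H\<in>proper_subgroups. Poly_Mapping.lookup n H * int (mark H g)))"
      unfolding subgroups_eq_insert
      by (subst sum.insert) (auto simp: mark_carrier[OF g], simp add: proper_subgroups_def)
    finally show ?thesis .
  qed
  then show ?thesis
    unfolding Brauer_relation_def carrier_free_Abelian_group_iff of_int_eq_0_iff[symmetric, where 'a = complex]
    by auto
qed

text \<open>Moving all terms with \<open>H \<noteq> G\<close> to the other side, a Brauer relation writes the constant
  coefficient of \<open>G\<close> as an element of \<open>proper_span\<close>.\<close>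

lemma Brauer_coefficients_eq: "Brauer_coefficients G = proper_constants"
proof (intro Set.set_eqI iffI)
  fix c assume "c \<in> Brauer_coefficients G"
  then obtain n where n: "c = Poly_Mapping.lookup n (carrier G)" "Brauer_relation G n"
    by (auto simp: Brauer_coefficients_def)
  have "c = (\<Sum>H\<in>proper_subgroups. - Poly_Mapping.lookup n H * int (mark H g))"
    if "g \<in> carrier G" for g
    using n(2) that by (simp add: Brauer_relation_iff n(1) sum_negf eq_neg_iff_add_eq_0)
  then show "c \<in> proper_constants"
    unfolding proper_constants_def proper_span_def
    by (auto intro!: exI[of _ "\<lambda>H. - Poly_Mapping.lookup n H"])
next
  fix c assume "c \<in> proper_constants"
  then obtain m where m: "\<forall>g\<in>carrier G. c = (\<Sum>H\<in>proper_subgroups. m H * int (mark H g))"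
    by (auto simp: proper_constants_def proper_span_def)
  define n where "n = Abs_poly_mapping (\<lambda>H. if H = carrier G then c
    else if H \<in> proper_subgroups then - m H else 0)"
  have "finite {H. (if H = carrier G then c else if H \<in> proper_subgroups then - m H else 0) \<noteq> 0}"
    by (rule finite_subset[OF _ finite_subgroups]) (auto simp: subgroups_eq_insert split: if_splits)
  then have lookup: "Poly_Mapping.lookup n = (\<lambda>H. if H = carrier G then c
    else if H \<in> proper_subgroups then - m H else 0)"
    unfolding n_def by (rule lookup_Abs_poly_mapping)
  have "Poly_Mapping.keys n \<subseteq> {H. subgroup H G}"
    by (auto simp: in_keys_iff lookup subgroups_eq_insert split: if_splits)
  moreover have "(\<Sum>H\<in>proper_subgroups. Poly_Mapping.lookup n H * int (mark H g)) = - c"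
    if "g \<in> carrier G" for g
  proof -
    have "(\<Sum>H\<in>proper_subgroups. Poly_Mapping.lookup n H * int (mark H g))
        = (\<Sum>H\<in>proper_subgroups. - (m H * int (mark H g)))"
      by (rule sum.cong) (auto simp: lookup proper_subgroups_def)
    then show ?thesis using m that by (simp add: sum_negf)
  qed
  ultimately have "Brauer_relation G n"
    unfolding Brauer_relation_iff by (simp add: lookup)
  then show "c \<in> Brauer_coefficients G"
    unfolding Brauer_coefficients_def by (auto intro!: exI[of _ n] simp: lookup)
qed

end

section \<open>Congruences between marks\<close>

context group
begin

lemma normal_in_subgroupI:
  assumes "subgroup K G" "subgroup L G" "K \<subseteq> L"
    and "\<And>x k. x \<in> L \<Longrightarrow> k \<in> K \<Longrightarrow> x \<otimes> k \<otimes> inv x \<in> K"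
  shows "K \<lhd> (G\<lparr>carrier := L\<rparr>)"
proof -
  interpret L: group "G\<lparr>carrier := L\<rparr>" by (rule subgroup_imp_group[OF assms(2)])
  show ?thesis
    using subgroup_incl[OF assms(1,2,3)] assms(2,4)
    by (intro L.normal_invI) (auto simp: m_inv_consistent)
qed

lemma generate_singleton: "c \<in> carrier G \<Longrightarrow> generate G {c} = range (\<lambda>k::int. c [^] k)"
  by (auto simp: generate_pow)

lemma subgroup_generate_singleton: "c \<in> carrier G \<Longrightarrow> subgroup (generate G {c}) G"
  by (rule generate_is_subgroup) simp

lemma mem_generate_singleton: "c \<in> carrier G \<Longrightarrow> c \<in> generate G {c}"
  by (rule generate.incl) simp

lemma generate_singleton_subset:
  "subgroup H G \<Longrightarrow> c \<in> H \<Longrightarrow> generate G {c} \<subseteq> H"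
  by (rule generate_subgroup_incl) auto

lemma conjugation_group_hom:
  assumes x: "x \<in> carrier G"
  shows "group_hom G G (\<lambda>y. x \<otimes> y \<otimes> inv x)"
proof (unfold_locales, rule homI)
  fix y z assume yz: "y \<in> carrier G" "z \<in> carrier G"
  have "(x \<otimes> y \<otimes> inv x) \<otimes> (x \<otimes> z \<otimes> inv x) = x \<otimes> y \<otimes> (inv x \<otimes> x) \<otimes> z \<otimes> inv x"
    using x yz by (simp only: m_assoc m_closed inv_closed)
  then show "x \<otimes> (y \<otimes> z) \<otimes> inv x = (x \<otimes> y \<otimes> inv x) \<otimes> (x \<otimes> z \<otimes> inv x)"
    using x yz by (simp add: m_assoc)
qed (use x in simp)

lemma conj_nat_pow:
  assumes "x \<in> carrier G" "y \<in> carrier G"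
  shows "(x \<otimes> y \<otimes> inv x) [^] (n::nat) = x \<otimes> y [^] n \<otimes> inv x"
  using group_hom.hom_nat_pow[OF conjugation_group_hom[OF assms(1)] assms(2)] by simp

text \<open>A subgroup of a normal cyclic subgroup is normal.\<close>

lemma generate_pow_normal:
  assumes c: "c \<in> carrier G" and norm: "generate G {c} \<lhd> G"
  shows "generate G {c [^] (n::nat)} \<lhd> G"
proof (rule normal_invI)
  show D: "subgroup (generate G {c [^] n}) G" using c by (intro subgroup_generate_singleton) simp
  fix x h assume x: "x \<in> carrier G" and "h \<in> generate G {c [^] n}"
  then obtain k :: int where h: "h = (c [^] n) [^] k" using c by (auto simp: generate_singleton)
  have "x \<otimes> c \<otimes> inv x \<in> generate G {c}"
    using normal_invE(2)[OF norm x] mem_generate_singleton[OF c] by simp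
  then obtain j :: int where j: "x \<otimes> c \<otimes> inv x = c [^] j" using c by (auto simp: generate_singleton)
  have cn: "x \<otimes> c [^] n \<otimes> inv x = (c [^] n) [^] j"
  proof -
    have "x \<otimes> c [^] n \<otimes> inv x = (c [^] j) [^] n" using conj_nat_pow[OF x c, of n] j by simp
    also have "\<dots> = (c [^] n) [^] j"
      using c by (simp add: int_pow_int[symmetric] int_pow_pow mult.commute)
    finally show ?thesis .
  qed
  interpret conj: group_hom G G "\<lambda>y. x \<otimes> y \<otimes> inv x" by (rule conjugation_group_hom[OF x])
  have "x \<otimes> h \<otimes> inv x = (x \<otimes> c [^] n \<otimes> inv x) [^] k"
    unfolding h using c by (intro conj.hom_int_pow) simp
  also have "\<dots> \<in> generate G {c [^] n}"
    unfolding cn using c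
    by (intro subgroup_int_pow_closed[OF D] mem_generate_singleton) simp
  finally show "x \<otimes> h \<otimes> inv x \<in> generate G {c [^] n}" .
qed

lemma mem_subgroup_of_coprime_pows:
  assumes D: "subgroup D G" and y: "y \<in> carrier G" "y [^] (a::nat) \<in> D" "y [^] (b::nat) \<in> D"
    and "coprime a b"
  shows "y \<in> D"
proof -
  obtain u v where uv: "u * int a + v * int b = 1"
    using bezout_int[of "int a" "int b"] assms(5) by auto
  have "y = y [^] (u * int a + v * int b)" using y(1) uv by (simp add: int_pow_1)
  also have "\<dots> = (y [^] a) [^] u \<otimes> (y [^] b) [^] v"
    using y(1) by (simp add: int_pow_mult int_pow_int[symmetric] int_pow_pow mult.commute)
  also have "\<dots> \<in> D"
    by (intro subgroup.m_closed[OF D] subgroup_int_pow_closed[OF D] y)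
  finally show ?thesis .
qed

lemma pow_index_mem_normal:
  assumes "N \<lhd> G" "x \<in> carrier G"
  shows "x [^] card (rcosets N) \<in> N"
proof -
  interpret N: normal N G by (rule assms(1))
  interpret Q: group "G Mod N" by (rule N.factorgroup_is_group)
  have "N #> x \<in> carrier (G Mod N)" using assms(2) by (simp add: carrier_FactGroup)
  then have "(N #> x) [^]\<^bsub>G Mod N\<^esub> card (rcosets N) = N"
    using Q.pow_order_eq_1 by (simp add: order_def FactGroup_def)
  then have "N #> (x [^] card (rcosets N)) = N" using N.FactGroup_pow[OF assms(2)] by simp
  then show ?thesis using coset_join1 assms(2) N.subgroup_axioms by blast
qed

lemma subgroup_inter_coprime:
  assumes D: "subgroup D G" and R: "subgroup R G" and cop: "coprime (card D) (card R)"
  shows "D \<inter> R = {\<one>}"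
proof -
  have DR: "subgroup (D \<inter> R) G" by (rule subgroups_Inter_pair[OF D R])
  have "card (D \<inter> R) dvd card D" "card (D \<inter> R) dvd card R"
    using card_subgroup_dvd[OF DR D] card_subgroup_dvd[OF DR R] by auto
  then have "card (D \<inter> R) = 1" using cop by (metis coprime_common_divisor_nat)
  then obtain z where "D \<inter> R = {z}" by (auto simp: card_1_singleton_iff)
  then show ?thesis using subgroup.one_closed[OF DR] by (metis singletonD)
qed

lemma card_set_mult_coprime:
  assumes D: "subgroup D G" and R: "subgroup R G" and cop: "coprime (card D) (card R)"
  shows "card (D <#> R) = card D * card R"
proof -
  have int: "D \<inter> R = {\<one>}" by (rule subgroup_inter_coprime[OF assms])
  have DG: "D \<subseteq> carrier G" "R \<subseteq> carrier G" using D R subgroup.subset by auto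
  have "inj_on (\<lambda>(d, r). d \<otimes> r) (D \<times> R)"
  proof (rule inj_onI, clarify)
    fix d r d' r' assume m: "d \<in> D" "r \<in> R" "d' \<in> D" "r' \<in> R" and eq: "d \<otimes> r = d' \<otimes> r'"
    then have c: "d \<in> carrier G" "r \<in> carrier G" "d' \<in> carrier G" "r' \<in> carrier G" using DG by auto
    have "inv d' \<otimes> d = r' \<otimes> inv r"
    proof -
      have "inv d' \<otimes> d = inv d' \<otimes> (d \<otimes> r) \<otimes> inv r" using c by (simp add: m_assoc)
      also have "\<dots> = r' \<otimes> inv r" unfolding eq using c by (simp add: m_assoc[symmetric])
      finally show ?thesis .
    qed
    moreover have "inv d' \<otimes> d \<in> D" using m D subgroup.m_inv_closed subgroup.m_closed by metis
    moreover have "r' \<otimes> inv r \<in> R" using m R subgroup.m_inv_closed subgroup.m_closed by metis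
    ultimately have "inv d' \<otimes> d = \<one>" "r' \<otimes> inv r = \<one>" using int by auto
    then have "d = d'" using c by (metis inv_closed inv_equality inv_inv)
    then show "d = d' \<and> r = r'" using eq c by simp
  qed
  moreover have "D <#> R = (\<lambda>(d, r). d \<otimes> r) ` (D \<times> R)" by (auto simp: set_mult_def)
  ultimately show ?thesis by (simp add: card_image card_cartesian_product)
qed

end

context finite_group
begin

lemma pow_mem_normal_in_subgroup:
  assumes "subgroup L G" "D \<lhd> (G\<lparr>carrier := L\<rparr>)" "card L = n * card D" "y \<in> L"
  shows "y [^] n \<in> D"
proof -
  interpret L: group "G\<lparr>carrier := L\<rparr>" by (rule subgroup_imp_group[OF assms(1)])
  have D: "subgroup D (G\<lparr>carrier := L\<rparr>)" using assms(2) normal_imp_subgroup by blast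
  have "card D > 0" using card_subgroup_pos[OF incl_subgroup[OF assms(1) D]] .
  moreover have "card (rcosets\<^bsub>G\<lparr>carrier := L\<rparr>\<^esub> D) * card D = n * card D"
    using L.lagrange[OF D] assms(3) by (simp add: order_def)
  ultimately have "card (rcosets\<^bsub>G\<lparr>carrier := L\<rparr>\<^esub> D) = n" by simp
  then have "y [^]\<^bsub>G\<lparr>carrier := L\<rparr>\<^esub> n \<in> D"
    using L.pow_index_mem_normal[OF assms(2), of y] assms(4) by simp
  then show ?thesis by (simp flip: nat_pow_consistent)
qed

text \<open>The congruence \<open>card_fixed_points_cong\<close> for a subgroup \<open>L\<close> acting on \<open>G / H\<close>.\<close>

lemma coset_fixed_points_cong:
  assumes H: "subgroup H G" and L: "subgroup L G" and K: "K \<lhd> (G\<lparr>carrier := L\<rparr>)"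
    and card: "card L = p ^ k * card K" and p: "prime p"
  shows "card {A \<in> lcosets H. \<forall>g\<in>L. g <# A = A} mod p
       = card {A \<in> lcosets H. \<forall>g\<in>K. g <# A = A} mod p"
proof -
  let ?\<phi> = "\<lambda>g. \<lambda>A\<in>lcosets H. g <# A"
  have act: "group_action (G\<lparr>carrier := L\<rparr>) (lcosets H) ?\<phi>"
    by (rule group_action.induced_action[OF group_action_lcosets[OF H] L])
  have "card {A \<in> lcosets H. \<forall>g\<in>L. ?\<phi> g A = A} mod p
      = card {A \<in> lcosets H. \<forall>g\<in>K. ?\<phi> g A = A} mod p"
    using group_action.card_fixed_points_cong[OF act _ _ p K, of k] card finite_subgroup[OF L]
    by simp
  moreover have "{A \<in> lcosets H. \<forall>g\<in>S. ?\<phi> g A = A} = {A \<in> lcosets H. \<forall>g\<in>S. g <# A = A}" for S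
    by auto
  ultimately show ?thesis by simp
qed

lemma fixed_by_generate_iff:
  assumes H: "subgroup H G" and c: "c \<in> carrier G" and A: "A \<in> lcosets H"
  shows "(\<forall>g\<in>generate G {c}. g <# A = A) \<longleftrightarrow> c <# A = A"
proof
  assume fixed: "c <# A = A"
  interpret act: group_action G "lcosets H" "\<lambda>g. \<lambda>A\<in>lcosets H. g <# A"
    by (rule group_action_lcosets[OF H])
  have st: "stabilizer G (\<lambda>g. \<lambda>A\<in>lcosets H. g <# A) A = {g \<in> carrier G. g <# A = A}"
    using A by (simp add: stabilizer_def)
  have "generate G {c} \<subseteq> {g \<in> carrier G. g <# A = A}"
    using act.stabilizer_subgroup[OF A] c fixed unfolding st
    by (intro generate_singleton_subset) auto
  then show "\<forall>g\<in>generate G {c}. g <# A = A" by auto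
qed (use mem_generate_singleton[OF c] in auto)

lemma mark_eq_card_fixed_by_generate:
  assumes "subgroup H G" "c \<in> carrier G"
  shows "mark H c = card {A \<in> lcosets H. \<forall>g\<in>generate G {c}. g <# A = A}"
proof -
  have "{A \<in> lcosets H. \<forall>g\<in>generate G {c}. g <# A = A} = {A \<in> lcosets H. c <# A = A}"
    using fixed_by_generate_iff[OF assms] by blast
  then show ?thesis using mark_eq_card_fixed[OF assms] by simp
qed

text \<open>The powers of \<open>g [^] (p ^ a)\<close> form a subgroup of \<open>p\<close>-power index in the powers of \<open>g\<close>.\<close>

lemma mark_pow_cong:
  assumes H: "subgroup H G" and g: "g \<in> carrier G" and p: "prime p"
  shows "mark H (g [^] (p ^ a)) mod p = mark H g mod p"
proof -
  let ?L = "generate G {g}" and ?K = "generate G {g [^] (p ^ a)}"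
  have gp: "g [^] (p ^ a) \<in> carrier G" using g by simp
  have L: "subgroup ?L G" and K: "subgroup ?K G"
    using subgroup_generate_singleton g gp by auto
  have KL: "?K \<subseteq> ?L"
    by (rule generate_singleton_subset[OF L])
      (use g in \<open>simp add: generate_singleton int_pow_int[symmetric]\<close>)
  have norm: "?K \<lhd> (G\<lparr>carrier := ?L\<rparr>)"
  proof (rule normal_in_subgroupI[OF K L KL])
    fix x k assume x: "x \<in> ?L" and k: "k \<in> ?K"
    then obtain i j :: int where ij: "x = g [^] i" "k = g [^] j"
      using KL g by (fastforce simp: generate_singleton)
    have "x \<otimes> k = k \<otimes> x"
      using g ij by (simp add: int_pow_mult[symmetric] add.commute)
    then have "x \<otimes> k \<otimes> inv x = k" using g ij by (simp add: m_assoc)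
    then show "x \<otimes> k \<otimes> inv x \<in> ?K" using k by simp
  qed
  have "gcd (ord g) (p ^ a) dvd p ^ a" by simp
  then obtain i where i: "gcd (ord g) (p ^ a) = p ^ i" using p divides_primepow_nat by blast
  have "p > 0" using p prime_gt_0_nat by simp
  then have "ord (g [^] (p ^ a)) = ord g div p ^ i" using ord_pow_gen[OF g, of "p ^ a"] i by simp
  moreover have "p ^ i dvd ord g" using i by (metis gcd_dvd1)
  ultimately have card: "card ?L = p ^ i * card ?K"
    using generate_pow_card[OF g] generate_pow_card[OF gp] by simp
  show ?thesis
    using coset_fixed_points_cong[OF H L norm card p] mark_eq_card_fixed_by_generate[OF H] g gp by simp
qed

text \<open>For proper \<open>H\<close> the group \<open>G\<close> has no fixed point on \<open>G / H\<close>, so the number of fixed points of a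
  normal subgroup of \<open>p\<close>-power index is divisible by \<open>p\<close>.\<close>

lemma prime_dvd_mark_normal_generator:
  assumes H: "H \<in> proper_subgroups" and c: "c \<in> carrier G" and norm: "generate G {c} \<lhd> G"
    and card: "card (carrier G) = p ^ k * card (generate G {c})" and p: "prime p"
  shows "p dvd mark H c"
proof -
  have HG: "subgroup H G" "H \<noteq> carrier G" using H by (auto simp: proper_subgroups_def)
  have none: "{A \<in> lcosets H. \<forall>g\<in>carrier G. g <# A = A} = {}"
  proof (rule ccontr)
    assume "{A \<in> lcosets H. \<forall>g\<in>carrier G. g <# A = A} \<noteq> {}"
    then obtain x where x: "x \<in> carrier G" "\<forall>g\<in>carrier G. g <# (x <# H) = x <# H"
      by (auto simp: LCOSETS_def)
    then have "H = carrier G" by (intro eq_carrier_if_l_coset_fixed[OF HG(1) x(1)]) blast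
    then show False using HG(2) by simp
  qed
  have "mark H c mod p = 0"
    using coset_fixed_points_cong[OF HG(1) subgroup_self, of "generate G {c}" p k] norm card p none
      mark_eq_card_fixed_by_generate[OF HG(1) c] by simp
  then show ?thesis by (rule mod_0_imp_dvd)
qed

lemma prime_dvd_proper_constants:
  assumes c: "c \<in> carrier G" and norm: "generate G {c} \<lhd> G"
    and card: "card (carrier G) = p ^ k * card (generate G {c})" and p: "prime p"
    and a: "a \<in> proper_constants"
  shows "int p dvd a"
proof -
  obtain m where "a = (\<Sum>H\<in>proper_subgroups. m H * int (mark H c))"
    using a c by (auto simp: proper_constants_def proper_span_def)
  then show ?thesis
    using prime_dvd_mark_normal_generator[OF _ c norm card p] by (auto intro!: dvd_sum dvd_mult)
qed

text \<open>The normalizer of \<open>D\<close>; as \<open>D\<close> is finite, it is enough that conjugation maps \<open>D\<close> into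
  itself.\<close>

lemma subgroup_normalizer_set:
  assumes D: "subgroup D G"
  shows "subgroup {x \<in> carrier G. \<forall>d\<in>D. x \<otimes> d \<otimes> inv x \<in> D} G"
proof (rule subgroupI)
  let ?N = "{x \<in> carrier G. \<forall>d\<in>D. x \<otimes> d \<otimes> inv x \<in> D}"
  have DG: "D \<subseteq> carrier G" using D subgroup.subset by auto
  show "?N \<noteq> {}" using DG by (auto intro!: exI[of _ \<one>])
  fix x assume x: "x \<in> ?N"
  have xG: "x \<in> carrier G" using x by simp
  show "inv x \<in> ?N"
  proof -
    have "inj_on (\<lambda>d. x \<otimes> d \<otimes> inv x) D"
      using conjugation_is_inj[OF xG] DG by (intro inj_onI) (meson subsetD)
    then have surj: "(\<lambda>d. x \<otimes> d \<otimes> inv x) ` D = D"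
      using x finite_subgroup[OF D] by (intro endo_inj_surj) auto
    have "inv x \<otimes> d \<otimes> inv (inv x) \<in> D" if d: "d \<in> D" for d
    proof -
      obtain e where e: "e \<in> D" "d = x \<otimes> e \<otimes> inv x" using surj d by blast
      then have "e \<in> carrier G" using DG by auto
      then have "inv x \<otimes> d \<otimes> inv (inv x) = e"
        using xG e(2) by (simp add: m_assoc) (simp add: m_assoc[symmetric])
      then show ?thesis using e by simp
    qed
    then show ?thesis using xG by simp
  qed
  fix y assume y: "y \<in> ?N"
  have "x \<otimes> y \<otimes> d \<otimes> inv (x \<otimes> y) \<in> D" if d: "d \<in> D" for d
  proof -
    have "x \<otimes> y \<otimes> d \<otimes> inv (x \<otimes> y) = x \<otimes> (y \<otimes> d \<otimes> inv y) \<otimes> inv x"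
      using x y d DG by (auto simp: inv_mult_group m_assoc)
    then show ?thesis using x y d by simp
  qed
  then show "x \<otimes> y \<in> ?N" using x y by simp
qed auto

end

section \<open>Quasi-elementary subgroups detecting an element\<close>

context finite_group
begin

text \<open>For \<open>n\<close> the \<open>q\<close>-part of the order of \<open>G\<close>, the power \<open>c = g [^] n\<close> has order prime to \<open>q\<close>. Let
  \<open>D\<close> be generated by \<open>c\<close>, let \<open>N\<close> be its normalizer, \<open>R\<close> a Sylow \<open>q\<close>-subgroup of \<open>N\<close>, and
  \<open>Q = D R\<close>. Since \<open>D\<close> consists of all elements of \<open>Q\<close> of order prime to \<open>q\<close>, the coset \<open>x Q\<close> is fixed
  by \<open>c\<close> iff \<open>x \<in> N\<close>. So \<open>mark Q c\<close> is the index of \<open>Q\<close> in \<open>N\<close>, which is prime to \<open>q\<close>, and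
  \<open>mark Q g\<close> is congruent to it modulo \<open>q\<close>.\<close>

lemma exists_mark_not_dvd:
  assumes q: "prime q" and g: "g \<in> carrier G"
  shows "\<exists>n k Q. subgroup Q G \<and> generate G {g [^] (n::nat)} \<lhd> (G\<lparr>carrier := Q\<rparr>)
     \<and> card Q = q ^ k * card (generate G {g [^] n}) \<and> coprime q (card (generate G {g [^] n}))
     \<and> \<not> q dvd mark Q g"
proof -
  have "card (carrier G) \<noteq> 0" using card_subgroup_pos[OF subgroup_self] by linarith
  then obtain a m where am: "card (carrier G) = q ^ a * m" "\<not> q dvd m"
    using multiplicity_decompose'[of "card (carrier G)" q] q by (metis not_prime_unit)
  have cop_m: "coprime (q ^ k) m" for k
    using q am(2) by (metis coprime_power_left_iff prime_imp_coprime)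
  define c where "c = g [^] (q ^ a)"
  define D where "D = generate G {c}"
  define N where "N = {x \<in> carrier G. \<forall>d\<in>D. x \<otimes> d \<otimes> inv x \<in> D}"
  have c: "c \<in> carrier G" using g by (simp add: c_def)
  have cm: "c [^] m = \<one>"
    using g pow_order_eq_1[OF g] am(1) by (simp add: c_def nat_pow_pow order_def)
  have D: "subgroup D G" unfolding D_def by (rule subgroup_generate_singleton[OF c])
  have cD: "c \<in> D" unfolding D_def by (rule mem_generate_singleton[OF c])
  have "card D dvd m"
    using cm pow_eq_id[OF c] generate_pow_card[OF c] by (simp add: D_def)
  then have cop_D: "coprime (q ^ k) (card D)" for k
    using cop_m[of k] coprime_divisors[OF dvd_refl] by blast
  have N: "subgroup N G" unfolding N_def by (rule subgroup_normalizer_set[OF D])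
  have DN: "D \<subseteq> N"
    using D subgroup.subset[OF D] by (auto simp: N_def intro!: subgroup.m_closed subgroup.m_inv_closed)
  have norm_N: "D \<lhd> (G\<lparr>carrier := N\<rparr>)"
    by (rule normal_in_subgroupI[OF D N DN]) (simp add: N_def)
  interpret N: group "G\<lparr>carrier := N\<rparr>" by (rule subgroup_imp_group[OF N])
  have "card N \<noteq> 0" using card_subgroup_pos[OF N] by linarith
  then obtain b n where bn: "card N = q ^ b * n" "\<not> q dvd n"
    using multiplicity_decompose'[of "card N" q] q by (metis not_prime_unit)
  obtain R where R: "subgroup R (G\<lparr>carrier := N\<rparr>)" "card R = q ^ b"
    using sylow_thm[OF q N.is_group, of b n] bn(1) finite_subgroup[OF N] by (auto simp: order_def)
  have RG: "subgroup R G" by (rule incl_subgroup[OF N R(1)])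
  define Q where "Q = D <#> R"
  have "subgroup Q (G\<lparr>carrier := N\<rparr>)"
    using second_isomorphism_grp.normal_set_mult_subgroup[of D "G\<lparr>carrier := N\<rparr>" R] norm_N R(1)
    by (simp add: second_isomorphism_grp_def second_isomorphism_grp_axioms_def Q_def)
  then have Q: "subgroup Q G" "Q \<subseteq> N"
    using incl_subgroup[OF N] subgroup.subset by force+
  have cardQ: "card Q = q ^ b * card D"
    unfolding Q_def using card_set_mult_coprime[OF D RG]
      cop_D[of b] R(2) by (simp add: coprime_commute mult.commute)
  have DQ: "D \<subseteq> Q"
    using subgroup.one_closed[OF RG] subgroup.subset[OF D] by (force simp: Q_def set_mult_def)
  have norm_Q: "D \<lhd> (G\<lparr>carrier := Q\<rparr>)"
    by (rule normal_in_subgroupI[OF D Q(1) DQ]) (use Q(2) in \<open>auto simp: N_def\<close>)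
  have conj_iff: "inv x \<otimes> c \<otimes> x \<in> Q \<longleftrightarrow> x \<in> N" if x: "x \<in> carrier G" for x
  proof
    assume y: "inv x \<otimes> c \<otimes> x \<in> Q"
    have ym: "(inv x \<otimes> c \<otimes> x) [^] m = \<one>"
      using conj_nat_pow[of "inv x" c m] x c cm by simp
    have "(inv x \<otimes> c \<otimes> x) [^] (q ^ b) \<in> D"
      by (rule pow_mem_normal_in_subgroup[OF Q(1) norm_Q cardQ y])
    then have yD: "inv x \<otimes> c \<otimes> x \<in> D"
      using mem_subgroup_of_coprime_pows[OF D, of "inv x \<otimes> c \<otimes> x" "q ^ b" m] cop_m[of b] ym x c
        subgroup.one_closed[OF D] by simp
    interpret conj: group_hom G G "\<lambda>y. inv x \<otimes> y \<otimes> inv (inv x)"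
      by (rule conjugation_group_hom) (use x in simp)
    have "inv x \<otimes> d \<otimes> inv (inv x) \<in> D" if d: "d \<in> D" for d
    proof -
      obtain k :: int where "d = c [^] k" using d c by (auto simp: D_def generate_singleton)
      then have "inv x \<otimes> d \<otimes> inv (inv x) = (inv x \<otimes> c \<otimes> x) [^] k"
        using conj.hom_int_pow[OF c, of k] x by simp
      then show ?thesis using subgroup_int_pow_closed[OF D yD] by simp
    qed
    then have "inv x \<in> N" using x by (simp add: N_def)
    then have "inv (inv x) \<in> N" using subgroup.m_inv_closed[OF N] by blast
    then show "x \<in> N" using x by simp
  next
    assume "x \<in> N"
    then have "inv x \<in> N" using subgroup.m_inv_closed[OF N] by blast
    then have "inv x \<otimes> c \<otimes> inv (inv x) \<in> D" using cD unfolding N_def by blast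
    then show "inv x \<otimes> c \<otimes> x \<in> Q" using x DQ by auto
  qed
  have "{x \<in> carrier G. inv x \<otimes> c \<otimes> x \<in> Q} = N"
    using conj_iff subgroup.subset[OF N] by blast
  then have "mark Q c * (q ^ b * card D) = q ^ b * n"
    using mark_mult_card[OF Q(1) c] cardQ bn(1) by simp
  then have "mark Q c * card D = n" using prime_gt_0_nat[OF q] by (simp add: mult.left_commute)
  then have "\<not> q dvd mark Q c" using bn(2) by auto
  then have "\<not> q dvd mark Q g"
    using mark_pow_cong[OF Q(1) g q, of a] by (simp add: c_def dvd_eq_mod_eq_0)
  moreover have "coprime q (card D)" using cop_D[of 1] by simp
  ultimately show ?thesis using Q(1) norm_Q cardQ unfolding D_def c_def by blast
qed

section \<open>Normal subgroups of prime index\<close>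

lemma card_generated_by_normal_le:
  assumes N: "N \<lhd> G" and y: "y \<in> carrier G" "y [^] p \<in> N" and p: "p > 0"
  shows "subgroup (N <#> generate G {y}) G" "N \<subseteq> N <#> generate G {y}" "y \<in> N <#> generate G {y}"
    "card (N <#> generate G {y}) \<le> p * card N"
proof -
  interpret N: normal N G by (rule N)
  have Y: "subgroup (generate G {y}) G" by (rule subgroup_generate_singleton[OF y(1)])
  show "subgroup (N <#> generate G {y}) G"
    using second_isomorphism_grp.normal_set_mult_subgroup[of N G "generate G {y}"] N Y
    by (simp add: second_isomorphism_grp_def second_isomorphism_grp_axioms_def)
  show "N \<subseteq> N <#> generate G {y}"
    using subgroup.one_closed[OF Y] N.subset by (force simp: set_mult_def)
  have "\<one> \<otimes> y \<in> N <#> generate G {y}"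
    using subgroup.one_closed[OF N.subgroup_axioms] mem_generate_singleton[OF y(1)]
    unfolding set_mult_def by blast
  then show "y \<in> N <#> generate G {y}" using y(1) by simp
  \<comment> \<open>As \<open>y [^] p \<in> N\<close>, exponents of \<open>y\<close> can be reduced modulo \<open>p\<close>.\<close>
  have "N <#> generate G {y} \<subseteq> (\<lambda>(n, i). n \<otimes> y [^] i) ` (N \<times> {..<p})"
  proof
    fix z assume "z \<in> N <#> generate G {y}"
    then obtain n k where n: "n \<in> N" and z: "z = n \<otimes> y [^] (k::int)"
      using y(1) by (auto simp: set_mult_def generate_singleton)
    define i where "i = nat (k mod int p)"
    have i: "int i = k mod int p" "i < p" using p by (auto simp: i_def nat_less_iff)
    have k: "k = int p * (k div int p) + int i" using i by simp
    have "y [^] k = (y [^] p) [^] (k div int p) \<otimes> y [^] i"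
      using y(1) by (subst k) (simp add: int_pow_mult int_pow_int[symmetric] int_pow_pow)
    moreover have "(y [^] p) [^] (k div int p) \<in> N"
      by (rule subgroup_int_pow_closed[OF N.subgroup_axioms y(2)])
    ultimately have "z = (n \<otimes> (y [^] p) [^] (k div int p)) \<otimes> y [^] i"
      "n \<otimes> (y [^] p) [^] (k div int p) \<in> N"
      using z n y(1) N.subset by (auto simp: m_assoc subsetD)
    then show "z \<in> (\<lambda>(n, i). n \<otimes> y [^] i) ` (N \<times> {..<p})" using i(2) by force
  qed
  then have "card (N <#> generate G {y}) \<le> card (N \<times> {..<p})"
    using finite_subgroup[OF N.subgroup_axioms] by (intro surj_card_le) auto
  then show "card (N <#> generate G {y}) \<le> p * card N" by (simp add: card_cartesian_product mult.commute)
qed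

text \<open>In a finite \<open>p\<close>-group every proper subgroup lies in a normal subgroup of index \<open>p\<close>; here the
  \<open>p\<close>-group is \<open>G / D\<close>. A maximal proper subgroup \<open>M\<close> above \<open>H\<close> acts on \<open>G / M\<close>, a set of
  \<open>p\<close>-power size fixed pointwise by \<open>D\<close>, so the number of its fixed points is divisible by \<open>p\<close>.
  Hence \<open>M\<close> is properly contained in its normalizer, which by maximality is \<open>G\<close>.\<close>

lemma exists_normal_prime_index:
  assumes p: "prime p" and D: "D \<lhd> G" "card (carrier G) = p ^ k * card D"
    and H: "H \<in> proper_subgroups" "D \<subseteq> H"
  shows "\<exists>M. M \<lhd> G \<and> H \<subseteq> M \<and> card (carrier G) = p * card M"
proof -
  have DG: "subgroup D G" using D normal_imp_subgroup by blast
  define F where "F = {M \<in> proper_subgroups. H \<subseteq> M}"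
  have finF: "finite F" by (simp add: F_def)
  have "H \<in> F" using H by (simp add: F_def)
  then have "Max (card ` F) \<in> card ` F" using finF by (intro Max_in) auto
  then obtain M where "M \<in> F" "card M = Max (card ` F)" by auto
  then have M: "M \<in> F" "\<And>M'. M' \<in> F \<Longrightarrow> card M' \<le> card M" using finF by auto
  have MG: "subgroup M G" "M \<noteq> carrier G" "H \<subseteq> M" using M(1) by (auto simp: F_def proper_subgroups_def)
  have DM: "D \<subseteq> M" using H MG by blast
  have max: "L = carrier G" if L: "subgroup L G" "M \<subseteq> L" "L \<noteq> M" for L
  proof (rule ccontr)
    assume "L \<noteq> carrier G"
    then have "L \<in> F" using L MG by (auto simp: F_def proper_subgroups_def)
    then have "card L \<le> card M" using M(2) by blast
    then show False using L finite_subgroup[OF L(1)] by (metis card_seteq)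
  qed
  have mult: "card M * card (lcosets M) = card (carrier G)"
    using card_lcosets[OF MG(1)] by (simp add: mult.commute)
  obtain t where t: "card M = t * card D" using card_subgroup_dvd[OF DG MG(1) DM] by (metis dvd_def mult.commute)
  have "t * card (lcosets M) = p ^ k"
    using mult D(2) t card_subgroup_pos[OF DG] by simp
  then have "t dvd p ^ k" "card (lcosets M) dvd p ^ k" by (metis dvd_triv_left, metis dvd_triv_right)
  then obtain i j where ij: "t = p ^ i" "card (lcosets M) = p ^ j"
    using divides_primepow_nat[OF p] by blast
  have "j \<noteq> 0"
  proof
    assume "j = 0"
    then have "card M = card (carrier G)" using mult ij by simp
    then show False using MG subgroup.subset[OF MG(1)] by (metis card_subset_eq finite_carrier)
  qed
  have normDM: "D \<lhd> (G\<lparr>carrier := M\<rparr>)"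
    using normal_invE(2)[OF D(1)] subgroup.subset[OF MG(1)]
    by (intro normal_in_subgroupI[OF DG MG(1) DM]) auto
  have fixD: "{A \<in> lcosets M. \<forall>g\<in>D. g <# A = A} = lcosets M"
  proof -
    have "g <# (x <# M) = x <# M" if "g \<in> D" "x \<in> carrier G" for g x
    proof -
      have "inv x \<otimes> g \<otimes> x \<in> D" using normal.inv_op_closed1[OF D(1)] that by blast
      then show ?thesis
        using l_coset_fixed_iff[OF MG(1)] that DM subgroup.subset[OF DG] by blast
    qed
    then show ?thesis by (auto simp: LCOSETS_def)
  qed
  have cardM: "card M = p ^ i * card D" using t ij by simp
  have "card {A \<in> lcosets M. \<forall>g\<in>M. g <# A = A} mod p = 0"
    using coset_fixed_points_cong[OF MG(1) MG(1) normDM cardM p] fixD ij(2) \<open>j \<noteq> 0\<close> by simp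
  moreover have M_fix: "M \<in> {A \<in> lcosets M. \<forall>g\<in>M. g <# A = A}"
    using subgroup_mem_lcosets[OF MG(1)] l_coset_eq_self_iff[OF MG(1)] subgroup.subset[OF MG(1)] by blast
  ultimately have "{A \<in> lcosets M. \<forall>g\<in>M. g <# A = A} \<noteq> {M}"
    using prime_gt_1_nat[OF p] by (metis is_singletonI is_singleton_altdef mod_less zero_neq_one)
  then obtain x where x: "x \<in> carrier G" "x <# M \<noteq> M" "\<forall>g\<in>M. g <# (x <# M) = x <# M"
    using M_fix by (auto simp: LCOSETS_def)
  define L where "L = {x \<in> carrier G. \<forall>d\<in>M. x \<otimes> d \<otimes> inv x \<in> M}"
  have L: "subgroup L G" unfolding L_def by (rule subgroup_normalizer_set[OF MG(1)])
  have M_L: "M \<subseteq> L"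
    using MG(1) subgroup.subset[OF MG(1)] by (auto simp: L_def intro!: subgroup.m_closed subgroup.m_inv_closed)
  have "inv x \<otimes> g \<otimes> inv (inv x) \<in> M" if "g \<in> M" for g
    using l_coset_fixed_iff[OF MG(1) x(1), of g] x that subgroup.subset[OF MG(1)] by auto
  then have "inv x \<in> L" using x by (simp add: L_def)
  moreover have "inv x \<notin> M"
    using x l_coset_eq_self_iff[OF MG(1) x(1)] subgroup.m_inv_closed[OF MG(1), of "inv x"] by auto
  ultimately have "L = carrier G" using max[OF L M_L] by blast
  then have normM: "M \<lhd> G" using MG(1) by (intro normal_invI) (auto simp: L_def)
  \<comment> \<open>The index is \<open>p\<close>: \<open>M\<close> and an element outside of \<open>M\<close> whose \<open>p\<close>-th power lies in \<open>M\<close> generate \<open>G\<close>.\<close>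
  obtain z where z: "z \<in> carrier G" "z \<notin> M" using MG subgroup.subset[OF MG(1)] by blast
  have "z [^] (p ^ k) \<in> M"
    using pow_mem_normal_in_subgroup[OF subgroup_self _ D(2)] D(1) z DM by auto
  then have "\<exists>l. z [^] (p ^ l) \<in> M" by blast
  define l where "l = (LEAST l. z [^] (p ^ l) \<in> M)"
  have l: "z [^] (p ^ l) \<in> M" unfolding l_def by (rule LeastI_ex) fact
  have "l \<noteq> 0" using l z by (metis nat_pow_eone power_0)
  then obtain l' where l': "l = Suc l'" by (cases l) auto
  define y where "y = z [^] (p ^ l')"
  have y: "y \<in> carrier G" "y [^] p \<in> M" "y \<notin> M"
    using z l l' not_less_Least[of l' "\<lambda>l. z [^] (p ^ l) \<in> M"]
    by (auto simp: y_def nat_pow_pow l_def[symmetric] mult.commute)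
  note gen = card_generated_by_normal_le[OF normM y(1,2) prime_gt_0_nat[OF p]]
  have "M <#> generate G {y} = carrier G" using max[OF gen(1,2)] gen(3) y(3) by blast
  then have "card M * p ^ j \<le> p * card M" using gen(4) mult ij by simp
  then have "p ^ j \<le> p" using card_subgroup_pos[OF MG(1)] by simp
  then have "j = 1"
    using \<open>j \<noteq> 0\<close> prime_gt_1_nat[OF p] by (metis One_nat_def Suc_lessI neq0_conv not_less power_one_right power_strict_increasing_iff)
  then show ?thesis using normM MG(3) mult ij by (auto simp: mult.commute)
qed

lemma mark_normal:
  assumes "M \<lhd> G" "card (carrier G) = r * card M" "g \<in> carrier G"
  shows "mark M g = (if g \<in> M then r else 0)"
proof -
  interpret M: normal M G by (rule assms(1))
  have "inv x \<otimes> g \<otimes> x \<in> M \<longleftrightarrow> g \<in> M" if x: "x \<in> carrier G" for x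
  proof
    assume "inv x \<otimes> g \<otimes> x \<in> M"
    then have "x \<otimes> (inv x \<otimes> g \<otimes> x) \<otimes> inv x \<in> M" using M.inv_op_closed2 x by blast
    then show "g \<in> M" using conjugation_is_surj x assms(3) by simp
  qed (use M.inv_op_closed1 x in blast)
  then have "{x \<in> carrier G. inv x \<otimes> g \<otimes> x \<in> M} = (if g \<in> M then carrier G else {})" by auto
  then show ?thesis using assms(2) card_subgroup_pos[OF M.subgroup_axioms] by (simp add: mark_def)
qed

end

section \<open>The coefficient ideal\<close>

lemma int_ideal_generator:
  fixes J :: "int set"
  assumes zero: "0 \<in> J" and add: "\<And>a b. a \<in> J \<Longrightarrow> b \<in> J \<Longrightarrow> a + b \<in> J"
    and mult: "\<And>a c. a \<in> J \<Longrightarrow> c * a \<in> J"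
  shows "\<exists>d\<in>J. \<forall>a\<in>J. d dvd a"
proof (cases "J = {0}")
  case False
  then obtain b where b: "b \<in> J" "b \<noteq> 0" using zero by auto
  have "sgn b * b = int (nat \<bar>b\<bar>)" by (simp add: sgn_if)
  then have "int (nat \<bar>b\<bar>) \<in> J" using mult[OF b(1), of "sgn b"] by simp
  then have ex: "\<exists>n>0. int n \<in> J" using b(2) by (intro exI[of _ "nat \<bar>b\<bar>"]) auto
  define n where "n = (LEAST n. n > 0 \<and> int n \<in> J)"
  have n: "n > 0" "int n \<in> J" using LeastI_ex[OF ex] by (auto simp: n_def)
  have "int n dvd a" if a: "a \<in> J" for a
  proof -
    have "a mod int n = a + (- (a div int n)) * int n" by (simp add: minus_div_mult_eq_mod [symmetric])
    moreover have "a + (- (a div int n)) * int n \<in> J" by (intro add mult a n(2))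
    ultimately have "a mod int n \<in> J" by (simp only:)
    then have "int (nat (a mod int n)) \<in> J" using n(1) by simp
    moreover have "nat (a mod int n) < n" using n(1) by (simp add: nat_less_iff)
    ultimately have "nat (a mod int n) = 0"
      using not_less_Least[of "nat (a mod int n)" "\<lambda>n. n > 0 \<and> int n \<in> J"] by (auto simp: n_def)
    then have "a mod int n \<le> 0" by simp
    then have "a mod int n = 0" using n(1) by (simp add: order_antisym)
    then show ?thesis by (rule mod_0_imp_dvd)
  qed
  then show ?thesis using n by blast
qed auto

lemma prime_divisor_of_int:
  fixes d :: int
  assumes "\<not> is_unit d"
  obtains q :: nat where "prime q" "int q dvd d"
proof (cases "d = 0")
  case True
  then show ?thesis using that[of 2] by simp
next
  case False
  then have "nat \<bar>d\<bar> \<noteq> 1" using assms by auto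
  then obtain q where q: "prime q" "q dvd nat \<bar>d\<bar>" using prime_factor_nat by blast
  then have "int q dvd d" by (simp add: int_dvd_int_iff [symmetric])
  then show ?thesis using that q(1) by blast
qed

lemma dvd_prime_power_le_prime:
  fixes t p :: nat
  assumes "prime p" "t dvd p ^ k" "t \<noteq> 1" "t \<le> p"
  shows "t = p"
proof -
  obtain i where i: "t = p ^ i" using divides_primepow_nat[OF assms(1)] assms(2) by blast
  then have "i \<noteq> 0" using assms(3) by (metis power_0)
  then have "p dvd t" "t > 0" using i prime_gt_0_nat[OF assms(1)] by auto
  then show ?thesis using assms(4) dvd_imp_le by (simp add: order_antisym)
qed

context group
begin

lemma cyclic_group_iff_generate: "cyclic_group G \<longleftrightarrow> (\<exists>x\<in>carrier G. generate G {x} = carrier G)"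
  unfolding cyclic_group using generate_singleton by metis

lemma cyclic_group_generate:
  assumes "c \<in> carrier G"
  shows "cyclic_group (G\<lparr>carrier := generate G {c}\<rparr>)"
  using cyclic_group_generated[of c] assms by (simp add: subgroup_generated_def)

lemma cyclic_subgroup_obtain_generator:
  assumes C: "subgroup C G" and cyc: "cyclic_group (G\<lparr>carrier := C\<rparr>)"
  obtains c where "c \<in> carrier G" "C = generate G {c}"
proof -
  interpret C: group "G\<lparr>carrier := C\<rparr>" by (rule subgroup_imp_group[OF C])
  obtain c where "c \<in> C" "C = range (\<lambda>n::int. c [^]\<^bsub>G\<lparr>carrier := C\<rparr>\<^esub> n)"
    using cyc C.cyclic_group by auto
  then have "c \<in> carrier G" "C = generate G {c}"
    using subgroup.subset[OF C] int_pow_consistent[OF C] by (auto simp: generate_singleton)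
  then show ?thesis by (rule that)
qed

end

context finite_group
begin

lemma p_quasi_elementaryI:
  assumes p: "prime p" and c: "c \<in> carrier G" and norm: "generate G {c} \<lhd> G"
    and card: "card (carrier G) = p ^ k * card (generate G {c})"
  shows "p_quasi_elementary p G"
proof -
  have C: "subgroup (generate G {c}) G" by (rule subgroup_generate_singleton[OF c])
  have "card (rcosets (generate G {c})) = p ^ k"
    using lagrange[OF C] card card_subgroup_pos[OF C] by (simp add: order_def)
  then show ?thesis
    unfolding p_quasi_elementary_def using p norm cyclic_group_generate[OF c] is_group by auto
qed

text \<open>In \<open>exists_mark_not_dvd\<close> the subgroup \<open>Q\<close> is either proper or all of \<open>G\<close>.\<close>

lemma exists_proper_mark_not_dvd_or_normal:
  assumes q: "prime q" and g: "g \<in> carrier G"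
  obtains H where "H \<in> proper_subgroups" "\<not> q dvd mark H g"
  | n k where "generate G {g [^] (n::nat)} \<lhd> G"
      "card (carrier G) = q ^ k * card (generate G {g [^] n})"
      "coprime q (card (generate G {g [^] n}))"
proof -
  obtain n k Q where Q: "subgroup Q G" "generate G {g [^] (n::nat)} \<lhd> (G\<lparr>carrier := Q\<rparr>)"
    "card Q = q ^ k * card (generate G {g [^] n})" "coprime q (card (generate G {g [^] n}))"
    "\<not> q dvd mark Q g"
    using exists_mark_not_dvd[OF assms] by blast
  show ?thesis
  proof (cases "Q = carrier G")
    case True
    then show ?thesis using Q that(2)[of n k] by simp
  next
    case False
    then show ?thesis using Q that(1)[of Q] by (simp add: proper_subgroups_def)
  qed
qed

text \<open>In a \<open>p\<close>-quasi-elementary group the normal cyclic subgroup of \<open>p\<close>-power index can be chosen of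
  order prime to \<open>p\<close>: at the generator \<open>c\<close> of any such subgroup the marks of all proper subgroups
  are divisible by \<open>p\<close>, which leaves only the second alternative above.\<close>

lemma p_quasi_elementary_obtain_complement:
  assumes qe: "p_quasi_elementary p G"
  obtains d k where "d \<in> carrier G" "generate G {d} \<lhd> G"
    "card (carrier G) = p ^ k * card (generate G {d})" "coprime p (card (generate G {d}))"
proof -
  obtain C j where p: "prime p" and C: "C \<lhd> G" "cyclic_group (G\<lparr>carrier := C\<rparr>)"
    "card (rcosets C) = p ^ j"
    using qe by (auto simp: p_quasi_elementary_def)
  have CG: "subgroup C G" using C(1) normal_imp_subgroup by blast
  obtain c where c: "c \<in> carrier G" "C = generate G {c}"
    by (rule cyclic_subgroup_obtain_generator[OF CG C(2)])
  have card: "card (carrier G) = p ^ j * card (generate G {c})"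
    using lagrange[OF CG] C(3) c(2) by (simp add: order_def)
  show ?thesis
  proof (rule exists_proper_mark_not_dvd_or_normal[OF p c(1)])
    fix H assume "H \<in> proper_subgroups" "\<not> p dvd mark H c"
    then show ?thesis
      using prime_dvd_mark_normal_generator[OF _ c(1) _ card p] C(1) c(2) by blast
  next
    fix n k
    assume "generate G {c [^] (n::nat)} \<lhd> G"
      "card (carrier G) = p ^ k * card (generate G {c [^] n})"
      "coprime p (card (generate G {c [^] n}))"
    then show ?thesis using that[of "c [^] n" k] c(1) by simp
  qed
qed

lemma ord_pow_coprime:
  assumes "x \<in> carrier G" "coprime (ord x) n"
  shows "ord (x [^] n) = ord x"
  using assms ord_pow_gen[OF assms(1), of n] by auto

text \<open>A finite group which is quasi-elementary for two different primes has a normal cyclic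
  subgroup of order prime to \<open>p\<close> and a cyclic normal Sylow \<open>p\<close>-subgroup; these commute and generate
  the group.\<close>

lemma cyclic_if_quasi_elementary_two_primes:
  assumes pq: "p_quasi_elementary p G" "p_quasi_elementary q G" "p \<noteq> q"
  shows "cyclic_group G"
proof -
  have prime: "prime p" "prime q" using pq by (auto simp: p_quasi_elementary_def)
  obtain d k where d: "d \<in> carrier G" "generate G {d} \<lhd> G"
    "card (carrier G) = p ^ k * card (generate G {d})" "coprime p (card (generate G {d}))"
    by (rule p_quasi_elementary_obtain_complement[OF pq(1)])
  obtain e l where e: "e \<in> carrier G" "generate G {e} \<lhd> G"
    "card (carrier G) = q ^ l * card (generate G {e})"
    by (rule p_quasi_elementary_obtain_complement[OF pq(2)])
  have "coprime p q" using prime pq(3) by (simp add: primes_coprime)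
  then have "coprime (p ^ k) (q ^ l)" by simp
  moreover have "p ^ k dvd q ^ l * ord e"
    using d(3) e(3) generate_pow_card[OF e(1)] by (metis dvd_triv_left)
  ultimately have "p ^ k dvd ord e" by (simp add: coprime_dvd_mult_right_iff)
  then obtain s where s: "ord e = p ^ k * s" by (auto elim: dvdE)
  have "ord e \<ge> 1" by (rule ord_ge_1[OF finite_carrier e(1)])
  then have s0: "s > 0" using s by (cases s) auto
  define y where "y = e [^] s"
  have y: "y \<in> carrier G" using e(1) by (simp add: y_def)
  have ord_y: "ord y = p ^ k" using ord_pow_gen[OF e(1), of s] s s0 by (simp add: y_def)
  have norm_y: "generate G {y} \<lhd> G" unfolding y_def by (rule generate_pow_normal[OF e(1,2)])
  have cop: "coprime (ord d) (p ^ k)"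
    using d(4) generate_pow_card[OF d(1)] by (simp add: coprime_commute)
  have int: "generate G {d} \<inter> generate G {y} = {\<one>}"
    using cop unfolding ord_y[symmetric] generate_pow_card[OF d(1)] generate_pow_card[OF y]
    by (intro subgroup_inter_coprime subgroup_generate_singleton d(1) y)
  have comm: "d \<otimes> y = y \<otimes> d"
  proof -
    have mem: "d \<in> generate G {d}" "y \<in> generate G {y}"
      using mem_generate_singleton d(1) y by auto
    have sub: "subgroup (generate G {d}) G" "subgroup (generate G {y}) G"
      using subgroup_generate_singleton d(1) y by auto
    have "d \<otimes> y \<otimes> inv d \<otimes> inv y \<in> generate G {y}"
      using normal_invE(2)[OF norm_y d(1) mem(2)] mem(2) sub(2)
      by (simp add: subgroup.m_closed subgroup.m_inv_closed)
    moreover have "d \<otimes> (y \<otimes> inv d \<otimes> inv y) \<in> generate G {d}"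
      using normal_invE(2)[OF d(2) y, of "inv d"] mem(1) sub(1)
      by (simp add: subgroup.m_closed subgroup.m_inv_closed)
    moreover have "d \<otimes> (y \<otimes> inv d \<otimes> inv y) = d \<otimes> y \<otimes> inv d \<otimes> inv y"
      using d(1) y by (simp add: m_assoc)
    ultimately have "d \<otimes> y \<otimes> inv d \<otimes> inv y = \<one>" using int by auto
    then have "d \<otimes> y \<otimes> inv (y \<otimes> d) = \<one>" using d(1) y by (simp add: inv_mult_group m_assoc)
    then have "inv (inv (y \<otimes> d)) = d \<otimes> y" using d(1) y by (intro inv_equality) auto
    then show ?thesis using d(1) y by simp
  qed
  define x where "x = d \<otimes> y"
  have x: "x \<in> carrier G" using d(1) y by (simp add: x_def)
  have pow: "x [^] n = d [^] n \<otimes> y [^] n" for n :: nat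
    unfolding x_def by (rule pow_mult_distrib[OF comm d(1) y])
  have ord_pow_dvd: "ord (x [^] n) dvd ord x" for n :: nat
    using pow_eq_id[of "x [^] n" "ord x"] x by (simp add: nat_pow_pow mult.commute[of n]) (simp flip: nat_pow_pow)
  have "y [^] (p ^ k) = \<one>" using pow_ord_eq_1[OF y] ord_y by simp
  then have "x [^] (p ^ k) = d [^] (p ^ k)" using pow d(1) by simp
  then have "ord d dvd ord x"
    using ord_pow_dvd[of "p ^ k"] ord_pow_coprime[OF d(1) cop] by simp
  moreover have "x [^] ord d = y [^] ord d" using pow[of "ord d"] pow_ord_eq_1[OF d(1)] y by simp
  then have "p ^ k dvd ord x"
    using ord_pow_dvd[of "ord d"] ord_pow_coprime[OF y, of "ord d"] cop ord_y
    by (simp add: coprime_commute)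
  ultimately have "ord d * p ^ k dvd ord x" using cop by (simp add: divides_mult)
  then have "card (carrier G) dvd card (generate G {x})"
    using d(3) generate_pow_card[OF d(1)] generate_pow_card[OF x] by (simp add: mult.commute)
  then have "card (carrier G) \<le> card (generate G {x})"
    using card_subgroup_pos[OF subgroup_generate_singleton[OF x]] by (rule dvd_imp_le)
  then have "generate G {x} = carrier G"
    using subgroup.subset[OF subgroup_generate_singleton[OF x]] by (intro card_seteq) auto
  then show ?thesis using cyclic_group_iff_generate x by blast
qed

lemma zero_mem_proper_constants: "0 \<in> proper_constants"
  by (simp add: proper_constants_def proper_span_zero)

lemma proper_constants_cyclic:
  assumes "cyclic_group G"
  shows "proper_constants = {0}"
proof -
  interpret comm: comm_group G by (rule cyclic_imp_abelian_group[OF assms])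
  obtain x where x: "x \<in> carrier G" "generate G {x} = carrier G"
    using assms cyclic_group_iff_generate by blast
  have "mark H x = 0" if "H \<in> proper_subgroups" for H
  proof -
    have H: "subgroup H G" "H \<noteq> carrier G" using that by (auto simp: proper_subgroups_def)
    have "x \<notin> H" using generate_singleton_subset[OF H(1), of x] x H subgroup.subset[OF H(1)] by auto
    moreover have "inv y \<otimes> x \<otimes> y = x" if "y \<in> carrier G" for y
      using that x(1) by (metis comm.m_comm inv_closed inv_solve_left m_assoc m_closed)
    ultimately have "{y \<in> carrier G. inv y \<otimes> x \<otimes> y \<in> H} = {}" by auto
    then show ?thesis by (simp only: mark_def card.empty div_0)
  qed
  then have "a = 0" if "a \<in> proper_constants" for a
    using that x(1) by (auto simp: proper_constants_def proper_span_def)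
  then show ?thesis using zero_mem_proper_constants by blast
qed

text \<open>The pairs of a proper subgroup \<open>H\<close> and a value of \<open>mark H\<close> on \<open>G\<close> which is not divisible by
  \<open>p\<close>. They index the factors in the products of functions \<open>v - mark H\<close> below; indexing by pairs
  rather than by elements of \<open>G\<close> makes it possible to add one factor with the value \<open>p\<close>.\<close>

definition prime_to_values :: "nat \<Rightarrow> ('a set \<times> nat) set" where
  "prime_to_values p = {(H, mark H g) | H g. H \<in> proper_subgroups \<and> g \<in> carrier G \<and> \<not> p dvd mark H g}"

lemma finite_prime_to_values: "finite (prime_to_values p)"
  by (rule finite_subset[of _ "(\<lambda>(H, g). (H, mark H g)) ` (proper_subgroups \<times> carrier G)"])
    (auto simp: prime_to_values_def)

lemma prime_not_dvd_prod_values: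
  assumes "prime p"
  shows "\<not> int p dvd (\<Prod>i\<in>prime_to_values p. int (snd i))"
  using assms prime_dvd_prod_iff[OF finite_prime_to_values, of "int p" "\<lambda>i. int (snd i)"]
  by (auto simp: prime_to_values_def)

lemma exists_constant_not_dvd:
  assumes q: "prime q" and "\<not> p_quasi_elementary q G"
  shows "\<exists>a\<in>proper_constants. \<not> int q dvd a"
proof
  show "(\<Prod>i\<in>prime_to_values q. int (snd i)) \<in> proper_constants"
  proof (rule proper_constants_prod[OF finite_prime_to_values])
    show "(\<lambda>g. int (mark (fst i) g)) \<in> proper_span" if "i \<in> prime_to_values q" for i
      using that by (intro proper_span_mark) (auto simp: prime_to_values_def)
    fix g assume g: "g \<in> carrier G"
    obtain H where H: "H \<in> proper_subgroups" "\<not> q dvd mark H g"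
    proof (rule exists_proper_mark_not_dvd_or_normal[OF q g])
      fix n k
      assume "generate G {g [^] (n::nat)} \<lhd> G" "card (carrier G) = q ^ k * card (generate G {g [^] n})"
      then show ?thesis using p_quasi_elementaryI[OF q, of "g [^] n" k] g assms(2) by simp
    qed
    then show "\<exists>i\<in>prime_to_values q. int (mark (fst i) g) = int (snd i)"
      using g by (intro bexI[of _ "(H, mark H g)"]) (auto simp: prime_to_values_def)
  qed
qed (rule prime_not_dvd_prod_values[OF q])

lemma proper_constants_not_quasi_elementary:
  assumes "\<not> quasi_elementary G"
  shows "proper_constants = UNIV"
proof -
  obtain d where d: "d \<in> proper_constants" "\<forall>a\<in>proper_constants. d dvd a"
    using int_ideal_generator[OF zero_mem_proper_constants proper_constants_add proper_constants_mult] by blast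
  have "is_unit d"
  proof (rule ccontr)
    assume "\<not> is_unit d"
    then obtain q :: nat where q: "prime q" "int q dvd d" by (rule prime_divisor_of_int)
    have "\<not> p_quasi_elementary q G" using assms by (auto simp: quasi_elementary_def)
    then show False using exists_constant_not_dvd[OF q(1)] d(2) q(2) by (meson dvd_trans)
  qed
  then have "a \<in> proper_constants" for a
    using proper_constants_mult[OF d(1), of "a div d"] by simp
  then show ?thesis by blast
qed

end

section \<open>Non-cyclic quasi-elementary groups\<close>

context finite_group
begin

text \<open>The quotient of \<open>G\<close> by \<open>M\<close> has order \<open>p\<close>, so \<open>D\<close> has trivial image in it.\<close>

lemma mem_normal_prime_index_of_coprime:
  assumes M: "M \<lhd> G" "card (carrier G) = p * card M"
    and D: "subgroup D G" "coprime p (card D)"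
  shows "D \<subseteq> M"
proof
  fix d assume d: "d \<in> D"
  interpret M: normal M G by (rule M(1))
  have dG: "d \<in> carrier G" using d subgroup.subset[OF D(1)] by blast
  have "d [^] p \<in> M"
    by (rule pow_mem_normal_in_subgroup[OF subgroup_self _ M(2) dG]) (use M(1) in simp)
  moreover have "d [^] card D = \<one>"
  proof -
    interpret D: group "G\<lparr>carrier := D\<rparr>" by (rule subgroup_imp_group[OF D(1)])
    show ?thesis
      using D.pow_order_eq_1[of d] d by (simp add: order_def flip: nat_pow_consistent)
  qed
  ultimately show "d \<in> M"
    using mem_subgroup_of_coprime_pows[OF M.subgroup_axioms dG _ _ D(2)]
      subgroup.one_closed[OF M.subgroup_axioms] by simp
qed

text \<open>The factor \<open>t\<close> is the length of the orbit of the coset \<open>M\<close> under the action of \<open>L\<close> on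
  \<open>G / M\<close>.\<close>

lemma card_eq_mult_card_inter:
  assumes L: "subgroup L G" and M: "M \<lhd> G" "card (carrier G) = r * card M"
  shows "\<exists>t. card L = t * card (L \<inter> M) \<and> t \<le> r"
proof -
  have MG: "subgroup M G" using M(1) normal_imp_subgroup by blast
  let ?\<phi> = "\<lambda>g. \<lambda>A\<in>lcosets M. g <# A"
  interpret act: group_action "G\<lparr>carrier := L\<rparr>" "lcosets M" ?\<phi>
    by (rule group_action.induced_action[OF group_action_lcosets[OF MG] L])
  have mem: "M \<in> lcosets M" by (rule subgroup_mem_lcosets[OF MG])
  have "stabilizer (G\<lparr>carrier := L\<rparr>) ?\<phi> M = L \<inter> M"
    using mem l_coset_eq_self_iff[OF MG] subgroup.subset[OF L] by (auto simp: stabilizer_def)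
  then have "card (orbit (G\<lparr>carrier := L\<rparr>) ?\<phi> M) * card (L \<inter> M) = card L"
    using act.orbit_stabilizer_theorem[OF mem] by (simp add: order_def)
  moreover have "card (orbit (G\<lparr>carrier := L\<rparr>) ?\<phi> M) \<le> card (lcosets M)"
  proof (rule card_mono[OF finite_lcosets])
    show "orbit (G\<lparr>carrier := L\<rparr>) ?\<phi> M \<subseteq> lcosets M"
    proof
      fix A assume "A \<in> orbit (G\<lparr>carrier := L\<rparr>) ?\<phi> M"
      then obtain g where "g \<in> carrier (G\<lparr>carrier := L\<rparr>)" "?\<phi> g M = A"
        unfolding orbit_def by blast
      then show "A \<in> lcosets M" by (rule act.element_image[OF _ mem])
    qed
  qed
  moreover have "card (lcosets M) = r"
    using card_lcosets[OF MG] M(2) card_subgroup_pos[OF MG] by simp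
  ultimately show ?thesis by metis
qed

text \<open>With \<open>N = M1 \<inter> M2\<close>, the quotient \<open>G / N\<close> has order \<open>p\<^sup>2\<close> and is not cyclic. It has \<open>p + 1\<close>
  subgroups of order \<open>p\<close>, and every element other than 1 lies in exactly one of them. Let \<open>X\<close> be the
  set of their preimages in \<open>G\<close>. The sum of \<open>mark M\<close> over \<open>M \<in> X\<close>, minus \<open>mark N\<close>, is
  \<open>(p + 1) p - p\<^sup>2 = p\<close> on \<open>N\<close> and \<open>p - 0\<close> elsewhere.\<close>

lemma prime_mem_proper_constants_of_two_normal:
  assumes p: "prime p" and D: "subgroup D G" "coprime p (card D)" "card (carrier G) = p ^ k * card D"
    and M1: "M1 \<lhd> G" "card (carrier G) = p * card M1"
    and M2: "M2 \<lhd> G" "card (carrier G) = p * card M2" and "M1 \<noteq> M2"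
  shows "int p \<in> proper_constants"
proof -
  have p0: "p > 0" "p > 1" using prime_gt_1_nat[OF p] by auto
  define N where "N = M1 \<inter> M2"
  have N: "N \<lhd> G" unfolding N_def by (rule normal_subgroup_intersect[OF M1(1) M2(1)])
  have sub: "subgroup M1 G" "subgroup M2 G" "subgroup N G"
    using M1(1) M2(1) N normal_imp_subgroup by auto
  have DN: "D \<subseteq> N"
    using mem_normal_prime_index_of_coprime[OF M1 D(1,2)]
      mem_normal_prime_index_of_coprime[OF M2 D(1,2)] by (simp add: N_def)
  have D_pos: "card D > 0" by (rule card_subgroup_pos[OF D(1)])
  have N_pos: "card N > 0" by (rule card_subgroup_pos[OF sub(3)])
  obtain t where t: "card M1 = t * card N" "t \<le> p"
    using card_eq_mult_card_inter[OF sub(1) M2] by (auto simp: N_def)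
  obtain s where s: "card N = s * card D"
    using card_subgroup_dvd[OF D(1) sub(3) DN] by (metis dvd_def mult.commute)
  have "card M1 = card M2" using M1(2) M2(2) p0 by simp
  then have "N \<noteq> M1"
    using \<open>M1 \<noteq> M2\<close> finite_subgroup[OF sub(2)] unfolding N_def by (metis card_subset_eq inf_le2)
  then have "t \<noteq> 1"
    using t(1) finite_subgroup[OF sub(1)] unfolding N_def by (metis card_subset_eq inf_le1 mult_1)
  have "p * t * s * card D = p ^ k * card D" using D(3) M1(2) t(1) s by (simp add: mult_ac)
  then have "p * t * s = p ^ k" using D_pos by simp
  then have "t dvd p ^ k" by (metis dvd_def mult.assoc mult.left_commute)
  then have "t = p" using dvd_prime_power_le_prime[OF p _ \<open>t \<noteq> 1\<close> t(2)] by blast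
  then have cardG: "card (carrier G) = p ^ 2 * card N" using M1(2) t(1) by (simp add: power2_eq_square)
  define X where "X = {M. M \<lhd> G \<and> N \<subseteq> M \<and> card (carrier G) = p * card M}"
  have X_sub: "subgroup M G" "card M = p * card N" if "M \<in> X" for M
    using that cardG p0 normal_imp_subgroup by (auto simp: X_def power2_eq_square)
  have finX: "finite X"
    by (rule finite_subset[OF _ finite_subgroups]) (use X_sub in auto)
  have X_proper: "X \<subseteq> proper_subgroups"
  proof
    fix M assume M: "M \<in> X"
    have "card M \<noteq> card (carrier G)" using X_sub(2)[OF M] cardG N_pos p0 by (simp add: power2_eq_square)
    then show "M \<in> proper_subgroups" using X_sub(1)[OF M] by (auto simp: proper_subgroups_def)
  qed
  have uniq: "\<exists>!M. M \<in> X \<and> g \<in> M" if g: "g \<in> carrier G" "g \<notin> N" for g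
  proof -
    have gp: "g [^] p \<in> N"
      using pow_mem_normal_in_subgroup[OF subgroup_self _ M1(2) g(1)] M1(1)
        pow_mem_normal_in_subgroup[OF subgroup_self _ M2(2) g(1)] M2(1) by (simp add: N_def)
    \<comment> \<open>The only candidate is \<open>L\<close>, generated by \<open>N\<close> and \<open>g\<close>, of order \<open>p\<close> times that of \<open>N\<close>.\<close>
    define L where "L = N <#> generate G {g}"
    have L: "subgroup L G" "N \<subseteq> L" "g \<in> L" "card L \<le> p * card N"
      using card_generated_by_normal_le[OF N g(1) gp p0(1)] by (simp_all add: L_def)
    obtain u where u: "card L = u * card N"
      using card_subgroup_dvd[OF sub(3) L(1,2)] by (metis dvd_def mult.commute)
    have "u \<noteq> 1"
    proof
      assume "u = 1"
      then have "N = L" using u L(2) finite_subgroup[OF L(1)] by (intro card_subset_eq) auto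
      then show False using L(3) g(2) by simp
    qed
    have "card L dvd card (carrier G)"
      by (rule card_subgroup_dvd[OF L(1) subgroup_self subgroup.subset[OF L(1)]])
    then have "u dvd p ^ 2" using u cardG N_pos by simp
    moreover have "u \<le> p" using L(4) u N_pos by simp
    ultimately have "u = p" using dvd_prime_power_le_prime[OF p _ \<open>u \<noteq> 1\<close>] by blast
    then have cardL: "card L = p * card N" using u by simp
    have "card L \<noteq> card (carrier G)" using cardL cardG N_pos p0 by (simp add: power2_eq_square)
    then have "L \<in> proper_subgroups" using L(1) by (auto simp: proper_subgroups_def)
    then obtain M where "M \<lhd> G" "L \<subseteq> M" "card (carrier G) = p * card M"
      using exists_normal_prime_index[OF p N cardG _ L(2)] by blast
    then have "M \<in> X" "g \<in> M" using L(2,3) by (auto simp: X_def)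
    moreover have "M' = L" if M': "M' \<in> X" "g \<in> M'" for M'
    proof -
      have "N \<subseteq> M'" "generate G {g} \<subseteq> M'"
        using M' generate_singleton_subset[OF X_sub(1)[OF M'(1)] M'(2)] by (auto simp: X_def)
      then have "L \<subseteq> M'"
        using subgroup.m_closed[OF X_sub(1)[OF M'(1)]] by (auto simp: L_def set_mult_def)
      then show "M' = L"
        using X_sub[OF M'(1)] cardL finite_subgroup by (metis card_subset_eq)
    qed
    ultimately show ?thesis by blast
  qed
  \<comment> \<open>The sets \<open>M - N\<close> with \<open>M \<in> X\<close> partition the complement of \<open>N\<close>.\<close>
  have card_X: "card X = p + 1"
  proof -
    have "carrier G - N = (\<Union>M\<in>X. M - N)"
    proof
      show "carrier G - N \<subseteq> (\<Union>M\<in>X. M - N)" using uniq by blast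
      show "(\<Union>M\<in>X. M - N) \<subseteq> carrier G - N" using subgroup.subset[OF X_sub(1)] by blast
    qed
    then have "card (carrier G - N) = card (\<Union>M\<in>X. M - N)" by simp
    also have "\<dots> = (\<Sum>M\<in>X. card (M - N))"
    proof (rule card_UN_disjoint[OF finX])
      show "\<forall>M\<in>X. finite (M - N)" using finite_subgroup[OF X_sub(1)] by blast
      show "\<forall>A\<in>X. \<forall>B\<in>X. A \<noteq> B \<longrightarrow> (A - N) \<inter> (B - N) = {}"
        using uniq subgroup.subset[OF X_sub(1)] by blast
    qed
    also have "\<dots> = (\<Sum>M\<in>X. p * card N - card N)"
    proof (rule sum.cong[OF refl])
      fix M assume "M \<in> X"
      then show "card (M - N) = p * card N - card N"
        using X_sub[OF \<open>M \<in> X\<close>] finite_subgroup[OF sub(3)] by (subst card_Diff_subset) (auto simp: X_def)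
    qed
    also have "\<dots> = card X * ((p - 1) * card N)" by (simp add: diff_mult_distrib)
    finally have "card (carrier G - N) = card X * (p - 1) * card N" by simp
    moreover have "card (carrier G - N) = card (carrier G) - card N"
      using finite_subgroup[OF sub(3)] subgroup.subset[OF sub(3)] by (rule card_Diff_subset)
    moreover have "p ^ 2 * card N - card N = (p + 1) * (p - 1) * card N"
    proof -
      obtain p' where "p = Suc p'" using p0 by (cases p) auto
      then show ?thesis by (simp add: power2_eq_square algebra_simps)
    qed
    ultimately have "card X * ((p - 1) * card N) = (p + 1) * ((p - 1) * card N)"
      using cardG by (simp only: mult.assoc)
    moreover have "(p - 1) * card N \<noteq> 0" using N_pos p0 by simp
    ultimately show ?thesis by (metis mult_cancel2)
  qed
  have eq: "(\<Sum>M\<in>X. int (mark M g)) - int (mark N g) = int p" if g: "g \<in> carrier G" for g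
  proof (cases "g \<in> N")
    case True
    have "mark M g = p" if "M \<in> X" for M using that mark_normal[of M p g] g True by (auto simp: X_def)
    then have "(\<Sum>M\<in>X. int (mark M g)) = int ((p + 1) * p)" using card_X by (simp add: algebra_simps)
    moreover have "mark N g = p ^ 2" using mark_normal[OF N cardG g] True by simp
    ultimately show ?thesis by (simp add: power2_eq_square algebra_simps)
  next
    case False
    obtain M where M: "M \<in> X" "g \<in> M" "\<And>M'. M' \<in> X \<Longrightarrow> g \<in> M' \<Longrightarrow> M' = M"
      using uniq[OF g False] by blast
    have "int (mark M' g) = (if M' = M then int p else 0)" if M': "M' \<in> X" for M'
    proof -
      have "mark M' g = (if g \<in> M' then p else 0)"
        using M' by (intro mark_normal g) (simp_all add: X_def)
      moreover have "g \<in> M' \<longleftrightarrow> M' = M" using M M' by blast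
      ultimately show ?thesis by simp
    qed
    then have "(\<Sum>M\<in>X. int (mark M g)) = int p" using finX M(1) by simp
    then show ?thesis using mark_normal[OF N cardG g] False by simp
  qed
  have "N \<in> proper_subgroups"
    using sub(3) cardG N_pos p0 by (auto simp: proper_subgroups_def power2_eq_square)
  then have "(\<lambda>g. (\<Sum>M\<in>X. int (mark M g)) - int (mark N g)) \<in> proper_span"
    using X_proper by (intro proper_span_diff proper_span_sum proper_span_mark) auto
  then show ?thesis
    unfolding proper_constants_def using eq by (auto intro: proper_span_cong)
qed

text \<open>The factor \<open>u\<close> is 1 if there are two normal subgroups of index \<open>p\<close>, and otherwise a product of
  marks prime to \<open>p\<close>.\<close>

lemma exists_prime_mult_mem_proper_constants:
  assumes p: "prime p" and qe: "p_quasi_elementary p G" and ncyc: "\<not> cyclic_group G"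
  shows "\<exists>u. \<not> int p dvd u \<and> int p * u \<in> proper_constants"
proof -
  obtain d k where d: "d \<in> carrier G" "generate G {d} \<lhd> G"
    "card (carrier G) = p ^ k * card (generate G {d})" "coprime p (card (generate G {d}))"
    by (rule p_quasi_elementary_obtain_complement[OF qe])
  let ?P = "\<lambda>M. M \<lhd> G \<and> card (carrier G) = p * card M"
  show ?thesis
  proof (cases "\<exists>M1 M2. ?P M1 \<and> ?P M2 \<and> M1 \<noteq> M2")
    case True
    then have "int p \<in> proper_constants"
      using prime_mem_proper_constants_of_two_normal[OF p subgroup_generate_singleton[OF d(1)] d(4,3)] by blast
    moreover have "\<not> int p dvd 1" using prime_gt_1_nat[OF p] by simp
    ultimately show ?thesis by (intro exI[of _ 1]) simp
  next
    case False
    \<comment> \<open>There is at most one normal subgroup of index \<open>p\<close>, and it contains the elements at which no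
      proper subgroup has a mark prime to \<open>p\<close>.\<close>
    have normal_ex: "\<exists>M. ?P M \<and> g \<in> M"
      if g: "g \<in> carrier G" and all: "\<forall>H\<in>proper_subgroups. p dvd mark H g" for g
    proof (rule exists_proper_mark_not_dvd_or_normal[OF p g])
      fix n k
      assume n: "generate G {g [^] (n::nat)} \<lhd> G"
        "card (carrier G) = p ^ k * card (generate G {g [^] n})"
      have L: "subgroup (generate G {g}) G" by (rule subgroup_generate_singleton[OF g])
      have "generate G {g} \<noteq> carrier G" using ncyc g cyclic_group_iff_generate by blast
      then have "generate G {g} \<in> proper_subgroups" using L by (simp add: proper_subgroups_def)
      moreover have "generate G {g [^] n} \<subseteq> generate G {g}"
        by (rule generate_singleton_subset[OF L])
          (use g in \<open>simp add: generate_singleton int_pow_int[symmetric]\<close>)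
      ultimately obtain M where "?P M" "generate G {g} \<subseteq> M"
        using exists_normal_prime_index[OF p n] by blast
      then show ?thesis using mem_generate_singleton[OF g] by blast
    qed (use all in blast)
    let ?I = "prime_to_values p" and ?u = "\<Prod>i\<in>prime_to_values p. int (snd i)"
    have covered: "\<exists>i\<in>?I. int (mark (fst i) g) = int (snd i)"
      if "g \<in> carrier G" "H \<in> proper_subgroups" "\<not> p dvd mark H g" for g H
      using that by (intro bexI[of _ "(H, mark H g)"]) (auto simp: prime_to_values_def)
    have span: "(\<lambda>g. int (mark (fst i) g)) \<in> proper_span" if "i \<in> ?I" for i
      using that by (intro proper_span_mark) (auto simp: prime_to_values_def)
    have "int p * ?u \<in> proper_constants"
    proof (cases "\<exists>M. ?P M")
      case True
      then obtain M where M: "M \<lhd> G" "card (carrier G) = p * card M" by blast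
      have M_proper: "M \<in> proper_subgroups"
        using M normal_imp_subgroup card_subgroup_pos[OF subgroup_self] prime_gt_1_nat[OF p]
        by (auto simp: proper_subgroups_def)
      \<comment> \<open>The pair \<open>(M, p)\<close> contributes the factor \<open>p - mark M\<close>, which vanishes on \<open>M\<close>.\<close>
      have "(\<Prod>i\<in>insert (M, p) ?I. int (snd i)) \<in> proper_constants"
      proof (rule proper_constants_prod[where f = "\<lambda>i g. int (mark (fst i) g)"])
        fix g assume g: "g \<in> carrier G"
        show "\<exists>i\<in>insert (M, p) ?I. int (mark (fst i) g) = int (snd i)"
        proof (cases "\<forall>H\<in>proper_subgroups. p dvd mark H g")
          case True
          then have "g \<in> M" using normal_ex[OF g] False M by blast
          then show ?thesis using mark_normal[OF M g] by simp
        qed (use covered[OF g] in blast)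
      qed (use finite_prime_to_values span proper_span_mark[OF M_proper] in auto)
      moreover have "(M, p) \<notin> ?I" by (auto simp: prime_to_values_def)
      ultimately show ?thesis using finite_prime_to_values by simp
    next
      case no: False
      have "?u \<in> proper_constants"
      proof (rule proper_constants_prod[where f = "\<lambda>i g. int (mark (fst i) g)"])
        fix g assume g: "g \<in> carrier G"
        show "\<exists>i\<in>?I. int (mark (fst i) g) = int (snd i)"
          using normal_ex[OF g] no covered[OF g] by blast
      qed (use finite_prime_to_values span in auto)
      then show ?thesis by (rule proper_constants_mult)
    qed
    then show ?thesis using prime_not_dvd_prod_values[OF p] by blast
  qed
qed

lemma proper_constants_quasi_elementary:
  assumes p: "prime p" and qe: "p_quasi_elementary p G" and ncyc: "\<not> cyclic_group G"
  shows "proper_constants = {int p * k | k. True}"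
proof
  obtain d k where d: "d \<in> carrier G" "generate G {d} \<lhd> G"
    "card (carrier G) = p ^ k * card (generate G {d})"
    by (rule p_quasi_elementary_obtain_complement[OF qe])
  show "proper_constants \<subseteq> {int p * k | k. True}"
    using prime_dvd_proper_constants[OF d p] by (auto simp: dvd_def)
  obtain c where c: "c \<in> proper_constants" "\<forall>a\<in>proper_constants. c dvd a"
    using int_ideal_generator[OF zero_mem_proper_constants proper_constants_add proper_constants_mult] by blast
  obtain u where u: "\<not> int p dvd u" "int p * u \<in> proper_constants"
    using exists_prime_mult_mem_proper_constants[OF assms] by blast
  \<comment> \<open>A common prime factor of the generator \<open>c\<close> and \<open>u\<close> would differ from \<open>p\<close> and divide all of the
    ideal.\<close>
  have "coprime c u"
  proof (rule ccontr)
    assume "\<not> coprime c u"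
    then have "\<not> is_unit (gcd c u)" by (simp add: coprime_iff_gcd_eq_1)
    then obtain q :: nat where q: "prime q" "int q dvd gcd c u" by (rule prime_divisor_of_int)
    then have "int q dvd c" "int q dvd u" by auto
    then have "q \<noteq> p" using u(1) by blast
    then have "\<not> p_quasi_elementary q G"
      using cyclic_if_quasi_elementary_two_primes[OF qe] ncyc by metis
    then obtain a where "a \<in> proper_constants" "\<not> int q dvd a" using exists_constant_not_dvd[OF q(1)] by blast
    then show False using c(2) \<open>int q dvd c\<close> by (meson dvd_trans)
  qed
  moreover have "c dvd int p * u" using c(2) u(2) by blast
  ultimately have "c dvd int p" by (simp add: coprime_dvd_mult_left_iff)
  then obtain e where "int p = e * c" by (auto simp: dvd_def mult.commute)
  then have "int p \<in> proper_constants" using proper_constants_mult[OF c(1), of e] by simp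
  then have "k * int p \<in> proper_constants" for k by (rule proper_constants_mult)
  then show "{int p * k | k. True} \<subseteq> proper_constants" by (auto simp: mult.commute[of "int p"])
qed

end

theorem theorem1:
  fixes G :: "('a, 'b) monoid_scheme"
  assumes "group G" and "finite (carrier G)"
  shows "(cyclic_group G \<longrightarrow> Brauer_coefficients G = {0}) \<and>
         (\<forall>p::nat. prime p \<and> p_quasi_elementary p G \<and> \<not> cyclic_group G \<longrightarrow>
            Brauer_coefficients G = {int p * k | k. True}) \<and>
         (\<not> quasi_elementary G \<longrightarrow> Brauer_coefficients G = UNIV)"
proof -
  interpret finite_group G
    using assms by (simp add: finite_group_def finite_group_axioms_def)
  show ?thesis
    unfolding Brauer_coefficients_eq
    using proper_constants_cyclic proper_constants_quasi_elementary proper_constants_not_quasi_elementary by blast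
qed

end
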